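(* Let $n\geq k\geq 2$ be integers. Let $A=(a_{ij})_{1\leq i,j\leq n}$ and $B=(b_{ij})_{1\leq i,j\leq n}$ in $M_n(\mathbb{R})$ be two $k$-positive (symmetric) matrices. Then $$\sum_{i=1}^n b_{ii}\, S_{k-1}(A[\{i\}^c])\geq k\,[S_k(A)]^{\frac{k-1}{k}}\,[S_k(B)]^{\frac{1}{k}}.$$
   Context: $M_n(\mathbb{R})$ is the set of $n\times n$ real matrices. For $N\ge 1$, $\lambda=(\lambda_1,\dots,\lambda_N)\in\mathbb{R}^N$ and $1\le j\le N$, $S_j(\lambda)=\sum_{1\leq i_1<\cdots<i_j\leq N}\lambda_{i_1}\cdots\lambda_{i_j}$ is the $j$-th elementary symmetric function. $\Gamma_k(n)=\{\lambda\in\mathbb{R}^n : S_j(\lambda)>0 \text{ for all } j=1,\dots,k\}$. For a symmetric real matrix $M$ of any size, $\lambda(M)$ denotes its eigenvalues (with multiplicity) and $S_j(M):=S_j(\lambda(M))$. A matrix $A\in M_n(\mathbb{R})$ is called $k$-positive if it is symmetric and $\lambda(A)\in\Gamma_k(n)$. For $J\subset\{1,\dots,n\}$, $J^c=\{1,\dots,n\}\setminus J$, and $A[J]$ is the principal submatrix of $A$ of size $|J|$ obtained by deleting the $i$-th row and column of $A$ for each $i\notin J$; thus $A[\{i\}^c]$ is $A$ with its $i$-th row and column deleted. *)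

theory Defs
  imports
    "Jordan_Normal_Form.Char_Poly"
    "Jordan_Normal_Form.DL_Submatrix"
begin

(* The tuples i_1 < ... < i_j are encoded as the j-element subsets I of the index set
   {0, ..., N - 1}, where N is the dimension of the vector; indices start at 0. *)
definition elem_sym :: "nat \<Rightarrow> real vec \<Rightarrow> real" where
  "elem_sym j v = (\<Sum>I \<in> {I. I \<subseteq> {..<dim_vec v} \<and> card I = j}. \<Prod>i\<in>I. v $ i)"

definition Gamma_cone :: "nat \<Rightarrow> nat \<Rightarrow> real vec set" where
  "Gamma_cone k n = {v \<in> carrier_vec n. \<forall>j\<in>{1..k}. elem_sym j v > 0}"

(* The real eigenvalues, repeated according to algebraic multiplicity and listed in increasing
   order.  For a symmetric real n x n matrix all roots of the characteristic polynomial are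
   real, so this is then a vector of dimension n.  The choice of order plays no role, as only
   symmetric functions of this vector are used. *)
definition eigenvalue_vec :: "real mat \<Rightarrow> real vec" where
  "eigenvalue_vec M = vec_of_list (sorted_list_of_multiset (proots (char_poly M)))"

definition elem_sym_mat :: "nat \<Rightarrow> real mat \<Rightarrow> real" where
  "elem_sym_mat j M = elem_sym j (eigenvalue_vec M)"

definition k_positive :: "nat \<Rightarrow> nat \<Rightarrow> real mat \<Rightarrow> bool" where
  "k_positive k n A \<longleftrightarrow>
     A \<in> carrier_mat n n \<and> transpose_mat A = A \<and> eigenvalue_vec A \<in> Gamma_cone k n"

(* Rows and columns with index in J are the ones that are kept. *)
definition principal_submatrix :: "real mat \<Rightarrow> nat set \<Rightarrow> real mat" where
  "principal_submatrix A J = submatrix A J J"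

end

theory Submission
  imports
    Defs
    "HOL-Analysis.Convex"
begin

text \<open>Diagonalise \<open>A\<close> and \<open>B\<close> orthogonally, with eigenvalue vectors \<open>\<lambda>\<close> and \<open>\<mu>\<close>. Reading off the
  diagonal of the adjugate of \<open>x I - A\<close> expresses \<open>S\<^sub>k\<^sub>-\<^sub>1(A[{i}\<^sup>c])\<close> as the average, with weights the
  squared entries of the eigenvector matrix, of the partial derivatives \<open>w\<^sub>j\<close> of \<open>S\<^sub>k\<close> at \<open>\<lambda>\<close>. The left
  hand side therefore has the form \<open>\<Sum> P\<^sub>j\<^sub>t w\<^sub>j \<mu>\<^sub>t\<close> with \<open>P\<close> doubly stochastic. For increasing
  \<open>\<lambda>\<close> and \<open>\<mu>\<close> the \<open>w\<^sub>j\<close> decrease, so by rearrangement the sum is at least \<open>\<Sum> w\<^sub>j \<mu>\<^sub>j\<close>, and only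
  Garding's inequality for vectors remains. It follows from the superadditivity of the quotients
  \<open>S\<^sub>j\<^sub>+\<^sub>1 / S\<^sub>j\<close> on the cone, which is proved by induction on \<open>j\<close> by the method of Marcus and Lopes;
  Newton's inequality shows that deleting a coordinate maps the cone for \<open>k + 1\<close> to that for \<open>k\<close>.\<close>

hide_const (open) Module.smult

interpretation of_real_poly_hom: map_poly_inj_idom_hom complex_of_real ..

section \<open>Newton's inequality\<close>

text \<open>The zero polynomial is included, so that the class is closed under derivatives.\<close>

definition real_rooted :: "real poly \<Rightarrow> bool" where
  "real_rooted p \<longleftrightarrow> (\<exists>c A. p = smult c (\<Prod>x\<in>#A. [:-x, 1:]))"

text \<open>Over the complex numbers \<open>p\<close> splits into linear factors. When all roots are
  real, each factor is the image of a real one, and injectivity of the embedding brings the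
  factorization back to the reals.\<close>

lemma real_rooted_of_complex_roots:
  fixes p :: "real poly"
  assumes real: "\<And>z. poly (map_poly complex_of_real p) z = 0 \<Longrightarrow> Im z = 0"
  shows "real_rooted p"
proof -
  let ?P = "map_poly complex_of_real p"
  have eq: "[:-z, 1:] = map_poly complex_of_real [:- Re z, 1:]" if "z \<in># proots ?P" for z
  proof -
    have "?P \<noteq> 0" using that by auto
    with that have "poly ?P z = 0" by simp
    from real[OF this] have "z = complex_of_real (Re z)" by (simp add: complex_eq_iff)
    then show ?thesis by (simp add: of_real_hom.map_poly_pCons_hom)
  qed
  have prod: "map_poly complex_of_real (\<Prod>x\<in>#A. [:- x, 1:]) =
      (\<Prod>x\<in>#A. map_poly complex_of_real [:- x, 1:])" for A
    unfolding of_real_poly_hom.hom_prod_mset multiset.map_comp o_def ..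
  have "?P = smult (lead_coeff ?P) (\<Prod>z\<in>#proots ?P. [:-z, 1:])"
    by (rule complex_poly_decompose_multiset[symmetric])
  also have "(\<Prod>z\<in>#proots ?P. [:-z, 1:]) = (\<Prod>z\<in>#proots ?P. map_poly complex_of_real [:- Re z, 1:])"
    using eq by (intro arg_cong[where f = prod_mset] image_mset_cong) 
  also have "\<dots> = map_poly complex_of_real (\<Prod>x\<in>#image_mset Re (proots ?P). [:- x, 1:])"
    unfolding prod unfolding multiset.map_comp o_def ..
  also have "smult (lead_coeff ?P) \<dots> =
      map_poly complex_of_real (smult (lead_coeff p) (\<Prod>x\<in>#image_mset Re (proots ?P). [:- x, 1:]))"
    by (simp add: of_real_hom.map_poly_hom_smult)
  finally have "p = smult (lead_coeff p) (\<Prod>x\<in>#image_mset Re (proots ?P). [:- x, 1:])"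
    by (rule of_real_poly_hom.injectivity)
  then show ?thesis unfolding real_rooted_def by blast
qed

text \<open>As in the Gauss-Lucas theorem, \<open>P' / P = \<Sum> 1 / (z - x)\<close> has negative imaginary part in the upper
  half-plane; multiplying by \<open>\<bar>P\<bar>\<^sup>2\<close> clears the denominators.\<close>

lemma Im_cnj_mult_pderiv_nonpos:
  fixes A :: "real multiset"
  assumes z: "0 < Im z"
  defines "P \<equiv> \<lambda>A. \<Prod>x\<in>#A. [:- complex_of_real x, 1:]"
  shows "Im (cnj (poly (P A) z) * poly (pderiv (P A)) z) \<le> 0 \<and>
    (A \<noteq> {#} \<longrightarrow> Im (cnj (poly (P A) z) * poly (pderiv (P A)) z) < 0)"
proof (induction A)
  case empty
  show ?case by (simp add: P_def)
next
  case (add x A)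
  have P: "P (add_mset x A) = [:- complex_of_real x, 1:] * P A" by (simp add: P_def)
  define l where "l = z - of_real x"
  define a where "a = poly (P A) z"
  define b where "b = poly (pderiv (P A)) z"
  have l: "l \<noteq> 0" "Im l = Im z" using z by (auto simp: l_def complex_eq_iff)
  have "a \<noteq> 0"
  proof -
    have "z \<noteq> complex_of_real x" for x using z by auto
    then have "poly (P A) z \<noteq> 0" unfolding P_def by (induction A) auto
    then show ?thesis by (simp add: a_def)
  qed
  have v: "poly (P (add_mset x A)) z = l * a"
    unfolding P by (simp add: l_def a_def algebra_simps)
  have d: "poly (pderiv (P (add_mset x A))) z = l * b + a"
    unfolding P pderiv_mult by (simp add: pderiv_pCons l_def a_def b_def algebra_simps)
  \<comment> \<open>Expanded, the product is \<open>|l|^2 * cnj a * b + |a|^2 * cnj l\<close>. The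
    second summand, due to the new root, has strictly negative imaginary part.\<close>
  have "Im (cnj (l * a) * (l * b + a)) = (cmod l)\<^sup>2 * Im (cnj a * b) - (cmod a)\<^sup>2 * Im l"
    unfolding cmod_power2 by (simp add: power2_eq_square algebra_simps)
  moreover have "(cmod l)\<^sup>2 * Im (cnj a * b) \<le> 0"
    using add by (intro mult_nonneg_nonpos) (auto simp: a_def b_def)
  moreover have "(cmod a)\<^sup>2 * Im l > 0" using z \<open>a \<noteq> 0\<close> l by simp
  ultimately show ?case unfolding v d by linarith
qed

text \<open>A nonzero derivative has no zero in the upper half-plane by the sign just computed, and
  none in the lower one by conjugation, its coefficients being real.\<close>

lemma real_rooted_pderiv:
  assumes "real_rooted p"
  shows "real_rooted (pderiv p)"
proof -
  obtain c A where p: "p = smult c (\<Prod>x\<in>#A. [:-x, 1:])"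
    using assms unfolding real_rooted_def by blast
  show ?thesis
  proof (cases "c = 0 \<or> A = {#}")
    case True
    \<comment> \<open>The derivative is zero here. Every complex number is then a root, so the
      criterion by complex roots cannot cover this case.\<close>
    then have "pderiv p = smult 0 (\<Prod>x\<in>#{#}. [:-x, 1:])" by (auto simp: p pderiv_smult)
    then show ?thesis unfolding real_rooted_def by blast
  next
    case False
    let ?Q = "\<Prod>x\<in>#A. [:- complex_of_real x, 1:]"
    have Q: "map_poly complex_of_real (\<Prod>x\<in>#A. [:- x, 1:]) = ?Q"
    proof -
      have "map_poly complex_of_real [:- x, 1:] = [:- complex_of_real x, 1:]" for x by simp
      then show ?thesis unfolding of_real_poly_hom.hom_prod_mset multiset.map_comp o_def by (simp only:)
    qed
    have D: "map_poly complex_of_real (pderiv p) = smult (of_real c) (pderiv ?Q)"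
      unfolding p pderiv_smult of_real_hom.map_poly_hom_smult of_real_hom.map_poly_pderiv Q ..
    have up: "poly (pderiv ?Q) z \<noteq> 0" if "0 < Im z" for z
      using Im_cnj_mult_pderiv_nonpos[OF that, of A] False by auto
    show ?thesis
    proof (rule real_rooted_of_complex_roots)
      fix z assume "poly (map_poly complex_of_real (pderiv p)) z = 0"
      moreover from this have "poly (map_poly complex_of_real (pderiv p)) (cnj z) = 0"
        by (subst real_poly_cnj_root_iff) simp_all
      ultimately have "poly (pderiv ?Q) z = 0" "poly (pderiv ?Q) (cnj z) = 0"
        using False unfolding D by simp_all
      then have "\<not> 0 < Im z" "\<not> 0 < Im (cnj z)" using up by blast+
      then show "Im z = 0" by simp
    qed
  qed
qed

text \<open>Away from the roots, \<open>(p'^2 - p * p'') / p^2\<close> is the sum of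
  \<open>1 / (x - a)^2\<close> over the roots \<open>a\<close>. Adding the roots one at a time gives
  the sign without division, so that \<open>x\<close> may itself be a root.\<close>

lemma real_rooted_Laguerre:
  assumes "real_rooted p"
  shows "poly p x * poly (pderiv (pderiv p)) x \<le> (poly (pderiv p) x)\<^sup>2"
proof -
  obtain c A where p: "p = smult c (\<Prod>a\<in>#A. [:-a, 1:])"
    using assms unfolding real_rooted_def by blast
  define P where "P A = (\<Prod>a\<in>#A. [:-a, 1:])" for A :: "real multiset"
  have *: "poly (P A) x * poly (pderiv (pderiv (P A))) x \<le> (poly (pderiv (P A)) x)\<^sup>2"
  proof (induction A)
    case empty
    show ?case by (simp add: P_def)
  next
    case (add a A)
    define u v w where "u = poly (P A) x" and "v = poly (pderiv (P A)) x"
      and "w = poly (pderiv (pderiv (P A))) x"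
    have P: "P (add_mset a A) = [:-a, 1:] * P A" by (simp add: P_def)
    have "poly (P (add_mset a A)) x = (x - a) * u"
      "poly (pderiv (P (add_mset a A))) x = u + (x - a) * v"
      "poly (pderiv (pderiv (P (add_mset a A)))) x = 2 * v + (x - a) * w"
      unfolding P u_def v_def w_def pderiv_mult pderiv_add
      by (simp_all add: pderiv_mult pderiv_pCons pderiv_add pderiv_diff pderiv_smult algebra_simps)
    moreover have "(u + (x - a) * v)\<^sup>2 - ((x - a) * u) * (2 * v + (x - a) * w)
        = u\<^sup>2 + (x - a)\<^sup>2 * (v\<^sup>2 - u * w)"
      by (simp add: power2_eq_square algebra_simps)
    moreover have "(x - a)\<^sup>2 * (v\<^sup>2 - u * w) \<ge> 0"
      using add by (simp add: u_def v_def w_def)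
    ultimately show ?case
      by (smt (verit) zero_le_power2)
  qed
  have "poly p x * poly (pderiv (pderiv p)) x = c\<^sup>2 * (poly (P A) x * poly (pderiv (pderiv (P A))) x)"
    by (simp add: p P_def pderiv_smult power2_eq_square)
  also have "\<dots> \<le> c\<^sup>2 * (poly (pderiv (P A)) x)\<^sup>2"
    using * by (intro mult_left_mono) auto
  also have "\<dots> = (poly (pderiv p) x)\<^sup>2"
    by (simp add: p P_def pderiv_smult power2_eq_square)
  finally show ?thesis .
qed

lemma poly_pderiv_funpow_0: "poly ((pderiv ^^ m) p) 0 = fact m * coeff p m"
  for p :: "real poly"
proof (induction m arbitrary: p)
  case (Suc m)
  have "poly ((pderiv ^^ Suc m) p) 0 = poly ((pderiv ^^ m) (pderiv p)) 0"
    by (simp only: funpow_Suc_right o_apply)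
  also have "\<dots> = fact m * coeff (pderiv p) m" by (rule Suc)
  finally show ?case by (simp add: coeff_pderiv algebra_simps)
qed (simp add: poly_0_coeff_0)

text \<open>Laguerre's inequality at 0 for the \<open>m\<close>-th derivative carries an extra
  factor \<open>(m + 2) / (m + 1)\<close> on the left. Dropping this factor is sound when the
  product on the left is positive; otherwise the claim is trivial.\<close>

lemma real_rooted_log_concave:
  assumes "real_rooted p"
  shows "coeff p m * coeff p (Suc (Suc m)) \<le> (coeff p (Suc m))\<^sup>2"
proof (cases "coeff p m * coeff p (Suc (Suc m)) \<le> 0")
  case True
  then show ?thesis by (smt (verit) zero_le_power2)
next
  case False
  have "real_rooted ((pderiv ^^ m) p)"
    by (induction m) (use assms real_rooted_pderiv in auto)
  from real_rooted_Laguerre[OF this, of 0]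
  have "poly ((pderiv ^^ m) p) 0 * poly ((pderiv ^^ Suc (Suc m)) p) 0 \<le> (poly ((pderiv ^^ Suc m) p) 0)\<^sup>2"
    by simp
  then have "(fact m)\<^sup>2 * ((1 + real m) * ((2 + real m) * (coeff p m * coeff p (Suc (Suc m)))))
      \<le> (fact m)\<^sup>2 * ((1 + real m) * ((1 + real m) * (coeff p (Suc m))\<^sup>2))"
    unfolding poly_pderiv_funpow_0 by (simp add: power2_eq_square algebra_simps)
  then have "(2 + real m) * (coeff p m * coeff p (Suc (Suc m))) \<le> (1 + real m) * (coeff p (Suc m))\<^sup>2"
    by (simp add: mult_le_cancel_left_pos)
  moreover have "(1 + real m) * (coeff p m * coeff p (Suc (Suc m))) \<le> (2 + real m) * (coeff p m * coeff p (Suc (Suc m)))"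
    using False by (intro mult_right_mono) auto
  ultimately have "(1 + real m) * (coeff p m * coeff p (Suc (Suc m))) \<le> (1 + real m) * (coeff p (Suc m))\<^sup>2"
    by linarith
  then show ?thesis by (simp add: mult_le_cancel_left_pos)
qed

section \<open>Elementary symmetric functions\<close>

text \<open>The index set is a parameter, so that coordinates can be deleted without
  renumbering.\<close>

definition esym :: "nat \<Rightarrow> nat set \<Rightarrow> (nat \<Rightarrow> real) \<Rightarrow> real" where
  "esym j X f = (\<Sum>I | I \<subseteq> X \<and> card I = j. \<Prod>i\<in>I. f i)"

lemma elem_sym_eq_esym: "elem_sym j v = esym j {..<dim_vec v} (\<lambda>i. v $ i)"
  by (simp add: elem_sym_def esym_def)

lemma esym_0 [simp]: "finite X \<Longrightarrow> esym 0 X f = 1"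
proof -
  assume "finite X"
  then have "{I. I \<subseteq> X \<and> card I = 0} = {{}}" by (auto dest: finite_subset)
  then show ?thesis by (simp add: esym_def)
qed

lemma esym_empty [simp]: "esym (Suc j) {} f = 0"
proof -
  have "{I. I \<subseteq> {} \<and> card I = Suc j} = ({} :: nat set set)" by auto
  then show ?thesis by (simp only: esym_def sum.empty)
qed

lemma esym_insert:
  assumes X: "finite X" "x \<notin> X"
  shows "esym (Suc j) (insert x X) f = esym (Suc j) X f + f x * esym j X f"
proof -
  let ?A = "{I. I \<subseteq> X \<and> card I = Suc j}" and ?B = "{I. I \<subseteq> X \<and> card I = j}"
  have eq: "{I. I \<subseteq> insert x X \<and> card I = Suc j} = ?A \<union> insert x ` ?B" (is "?L = ?R")
  proof (intro equalityI subsetI)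
    fix I assume I: "I \<in> ?L"
    then have fin: "finite I" using X finite_subset by auto
    show "I \<in> ?R"
    proof (cases "x \<in> I")
      case True
      then have "I = insert x (I - {x})" "I - {x} \<in> ?B" using I fin by auto
      then show ?thesis by blast
    qed (use I in auto)
  next
    fix I assume "I \<in> ?R"
    then show "I \<in> ?L"
    proof
      assume "I \<in> insert x ` ?B"
      then obtain J where J: "I = insert x J" "J \<subseteq> X" "card J = j" by auto
      then have "finite J" "x \<notin> J" using X finite_subset by auto
      then show ?thesis using J by auto
    qed auto
  qed
  have inj: "inj_on (insert x) ?B"
    using X(2) by (intro inj_onI) (auto simp: set_eq_iff)
  have "esym (Suc j) (insert x X) f = (\<Sum>I\<in>?A. \<Prod>i\<in>I. f i) + (\<Sum>I\<in>insert x ` ?B. \<Prod>i\<in>I. f i)"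
    unfolding esym_def eq using X by (intro sum.union_disjoint) auto
  also have "(\<Sum>I\<in>insert x ` ?B. \<Prod>i\<in>I. f i) = (\<Sum>I\<in>?B. \<Prod>i\<in>insert x I. f i)"
    using inj by (simp add: sum.reindex)
  also have "\<dots> = (\<Sum>I\<in>?B. f x * (\<Prod>i\<in>I. f i))"
  proof (intro sum.cong refl)
    fix I assume "I \<in> ?B"
    then have "finite I" "x \<notin> I" using X finite_subset by auto
    then show "(\<Prod>i\<in>insert x I. f i) = f x * (\<Prod>i\<in>I. f i)" by simp
  qed
  finally show ?thesis by (simp add: esym_def sum_distrib_left)
qed

lemma esym_remove:
  assumes "finite X" "i \<in> X"
  shows "esym (Suc j) X f = esym (Suc j) (X - {i}) f + f i * esym j (X - {i}) f"
  using esym_insert[of "X - {i}" i j f] assms by (simp add: insert_absorb)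

lemma esym_eq_0: "finite X \<Longrightarrow> card X < j \<Longrightarrow> esym j X f = 0"
proof -
  assume "finite X" "card X < j"
  then have "{I. I \<subseteq> X \<and> card I = j} = {}" using card_mono leD by blast
  then show ?thesis unfolding esym_def by (simp only: sum.empty)
qed

lemma esym_1: "finite X \<Longrightarrow> esym (Suc 0) X f = sum f X"
  by (induction X rule: finite_induct) (simp_all add: esym_insert)

lemma esym_scale: "esym j X (\<lambda>i. t * f i) = t ^ j * esym j X f"
  unfolding esym_def sum_distrib_left
  by (intro sum.cong refl) (auto simp: prod.distrib)

text \<open>Euler's identity for a homogeneous function of degree \<open>j + 1\<close>:
  \<open>esym j (X - {i}) f\<close> is the partial derivative of \<open>esym (Suc j) X\<close> in
  coordinate \<open>i\<close>.\<close>

lemma esym_euler: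
  assumes "finite X"
  shows "(\<Sum>i\<in>X. f i * esym j (X - {i}) f) = real (Suc j) * esym (Suc j) X f"
  using assms
proof (induction X arbitrary: j rule: finite_induct)
  case (insert x X)
  have rem: "insert x X - {i} = insert x (X - {i})" if "i \<in> X" for i
    using that insert.hyps by auto
  have main: "(\<Sum>i\<in>insert x X. f i * esym j (insert x X - {i}) f)
     = f x * esym j X f + (\<Sum>i\<in>X. f i * esym j (insert x (X - {i})) f)"
    using insert.hyps by (simp add: rem)
  show ?case
  proof (cases j)
    case 0
    then show ?thesis unfolding main using insert by (simp add: esym_1)
  next
    case (Suc m)
    have "(\<Sum>i\<in>X. f i * esym j (insert x (X - {i})) f)
        = (\<Sum>i\<in>X. f i * esym j (X - {i}) f) + f x * (\<Sum>i\<in>X. f i * esym m (X - {i}) f)"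
      using insert.hyps
      by (simp add: Suc esym_insert sum.distrib sum_distrib_left algebra_simps)
    then show ?thesis unfolding main insert.IH using insert.hyps
      by (simp add: Suc esym_insert algebra_simps)
  qed
qed simp

text \<open>Vieta's formula, free of signs because the roots are \<open>- f i\<close>. The relation
  \<open>m + j = card X\<close> avoids truncated subtraction.\<close>

lemma coeff_prod_linear:
  assumes "finite X" "m + j = card X"
  shows "coeff (\<Prod>i\<in>X. [:f i, 1:]) m = esym j X f"
  using assms
proof (induction X arbitrary: m j rule: finite_induct)
  case (insert x X)
  have deg: "degree (\<Prod>i\<in>X. [:f i, 1:]) = card X"
    by (subst degree_prod_eq_sum_degree) auto
  have P: "(\<Prod>i\<in>insert x X. [:f i, 1:]) = [:f x, 1:] * (\<Prod>i\<in>X. [:f i, 1:])"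
    using insert.hyps by simp
  have card: "m + j = Suc (card X)" using insert.prems insert.hyps by simp
  have c: "coeff (\<Prod>i\<in>insert x X. [:f i, 1:]) m =
      f x * coeff (\<Prod>i\<in>X. [:f i, 1:]) m + (case m of 0 \<Rightarrow> 0 | Suc m' \<Rightarrow> coeff (\<Prod>i\<in>X. [:f i, 1:]) m')"
    unfolding P by (simp add: coeff_pCons split: nat.split)
  show ?case
  proof (cases j)
    case 0
    then have m: "m = Suc (card X)" using card by simp
    then have "coeff (\<Prod>i\<in>X. [:f i, 1:]) m = 0" using deg by (intro coeff_eq_0) simp
    then show ?thesis unfolding c using insert.IH[of "card X" 0] insert.hyps 0 m by simp
  next
    case (Suc j')
    then have 1: "coeff (\<Prod>i\<in>X. [:f i, 1:]) m = esym j' X f"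
      using card by (intro insert.IH) simp
    show ?thesis
    proof (cases m)
      case 0
      then have "esym j X f = 0" using card insert.hyps by (intro esym_eq_0) auto
      then show ?thesis unfolding c 1 using insert.hyps by (simp add: 0 Suc esym_insert)
    next
      case (Suc m')
      then have "coeff (\<Prod>i\<in>X. [:f i, 1:]) m' = esym j X f"
        using card by (intro insert.IH) simp
      then show ?thesis unfolding c 1 using insert.hyps by (simp add: Suc \<open>j = Suc j'\<close> esym_insert)
    qed
  qed
qed simp

text \<open>The polynomial with roots \<open>- f i\<close> is real-rooted and its coefficients, read
  downwards, are the symmetric functions, so this is log-concavity of coefficients. If
  \<open>j + 2\<close> exceeds the size of \<open>X\<close>, the left side vanishes.\<close>

lemma esym_Newton:
  assumes "finite X"
  shows "esym j X f * esym (Suc (Suc j)) X f \<le> (esym (Suc j) X f)\<^sup>2"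
proof (cases "Suc (Suc j) \<le> card X")
  case True
  let ?p = "\<Prod>i\<in>X. [:f i, 1:]"
  define m where "m = card X - Suc (Suc j)"
  have "?p = smult 1 (\<Prod>x\<in>#image_mset (\<lambda>i. - f i) (mset_set X). [:-x, 1:])"
    by (simp add: multiset.map_comp o_def prod_unfold_prod_mset)
  then have "real_rooted ?p" unfolding real_rooted_def by blast
  from real_rooted_log_concave[OF this, of m]
  show ?thesis using True assms
      coeff_prod_linear[of X m "Suc (Suc j)" f] coeff_prod_linear[of X "Suc m" "Suc j" f]
      coeff_prod_linear[of X "Suc (Suc m)" j f]
    by (simp add: m_def mult.commute)
next
  case False
  then show ?thesis using assms esym_eq_0[of X "Suc (Suc j)" f] by simp
qed

section \<open>Concavity on the Garding cone\<close>

text \<open>The cone \<open>Gamma_cone\<close> over an arbitrary index set. Starting at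
  \<open>j = 0\<close> covers the denominators of all quotients \<open>S_(j+1) / S_j\<close>
  uniformly.\<close>

definition Garding :: "nat \<Rightarrow> nat set \<Rightarrow> (nat \<Rightarrow> real) set" where
  "Garding k X = {f. \<forall>j\<le>k. 0 < esym j X f}"

lemma GardingD: "f \<in> Garding k X \<Longrightarrow> j \<le> k \<Longrightarrow> 0 < esym j X f"
  by (simp add: Garding_def)

lemma Garding_antimono: "f \<in> Garding k X \<Longrightarrow> j \<le> k \<Longrightarrow> f \<in> Garding j X"
  by (simp add: Garding_def)

lemma Garding_SucI: "f \<in> Garding k X \<Longrightarrow> 0 < esym (Suc k) X f \<Longrightarrow> f \<in> Garding (Suc k) X"
  by (auto simp: Garding_def le_Suc_eq)

lemma Garding_scale: "f \<in> Garding k X \<Longrightarrow> 0 < t \<Longrightarrow> (\<lambda>i. t * f i) \<in> Garding k X"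
  by (simp add: Garding_def esym_scale)

text \<open>Let \<open>a\<close>, \<open>b\<close>, \<open>c\<close> be three consecutive symmetric
  functions of the remaining coordinates, with \<open>a > 0\<close> by induction. Positivity on
  \<open>X\<close> reads \<open>b > - f i * a\<close> and \<open>c > - f i * b\<close>; if
  \<open>b\<close> were not positive, these would force \<open>a * c > b^2\<close>, against Newton.
  Using \<open>c\<close> costs one level of the cone.\<close>

lemma Garding_remove:
  assumes X: "finite X" "i \<in> X" and f: "f \<in> Garding (Suc k) X"
  shows "f \<in> Garding k (X - {i})"
proof -
  have "0 < esym j (X - {i}) f" if "j \<le> k" for j
    using that
  proof (induction j)
    case 0
    then show ?case using X by simp
  next
    case (Suc j)
    define a b c where "a = esym j (X - {i}) f" and "b = esym (Suc j) (X - {i}) f"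
      and "c = esym (Suc (Suc j)) (X - {i}) f"
    have a: "0 < a" using Suc by (simp add: a_def)
    have 1: "0 < b + f i * a"
      using GardingD[OF f, of "Suc j"] Suc.prems esym_remove[OF X, of j f] by (simp add: a_def b_def)
    have 2: "0 < c + f i * b"
      using GardingD[OF f, of "Suc (Suc j)"] Suc.prems esym_remove[OF X, of "Suc j" f]
      by (simp add: c_def b_def)
    have newton: "a * c \<le> b\<^sup>2"
      using esym_Newton[of "X - {i}" j f] X by (simp add: a_def b_def c_def)
    have "0 < b"
    proof (rule ccontr)
      assume "\<not> 0 < b"
      then have b: "b \<le> 0" by simp
      have "b\<^sup>2 = (- b) * (- b)" by (simp add: power2_eq_square)
      also have "\<dots> \<le> (f i * a) * (- b)" using 1 b by (intro mult_right_mono) auto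
      also have "\<dots> = a * (- (f i * b))" by simp
      also have "\<dots> < a * c" using a 2 by (intro mult_strict_left_mono) auto
      finally show False using newton by simp
    qed
    then show ?case by (simp add: b_def)
  qed
  then show ?thesis by (simp add: Garding_def)
qed

section \<open>Superadditivity of quotients of consecutive symmetric functions\<close>

definition esym_ratio :: "nat \<Rightarrow> nat set \<Rightarrow> (nat \<Rightarrow> real) \<Rightarrow> real" where
  "esym_ratio k X f = esym (Suc k) X f / esym k X f"

lemma esym_ratio_pos: "f \<in> Garding (Suc k) X \<Longrightarrow> 0 < esym_ratio k X f"
  by (simp add: esym_ratio_def GardingD)

lemma esym_ratio_remove:
  assumes X: "finite X" "i \<in> X" and f: "f \<in> Garding (Suc k) X"
  shows "f i + esym_ratio k (X - {i}) f = esym (Suc k) X f / esym k (X - {i}) f"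
    and "0 < f i + esym_ratio k (X - {i}) f"
proof -
  have "0 < esym k (X - {i}) f" by (rule GardingD[OF Garding_remove[OF X f]]) simp
  then show *: "f i + esym_ratio k (X - {i}) f = esym (Suc k) X f / esym k (X - {i}) f"
    unfolding esym_ratio_def esym_remove[OF X, of k f] by (simp add: field_simps)
  show "0 < f i + esym_ratio k (X - {i}) f"
    unfolding * using \<open>0 < esym k (X - {i}) f\<close> GardingD[OF f, of "Suc k"] by simp
qed

text \<open>Divide Euler's identity by \<open>S_(k+1)(X)\<close> and eliminate
  \<open>S_(k+1)(X - {i})\<close> by the deletion recursion. The next quotient becomes a linear term
  minus squares over denominators built from the previous quotient, the form in which concavity can
  be passed on.\<close>

lemma esym_ratio_Suc:
  assumes X: "finite X" and f: "f \<in> Garding (Suc k) X"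
  shows "real (Suc (Suc k)) * esym_ratio (Suc k) X f =
    (\<Sum>i\<in>X. f i - (f i)\<^sup>2 / (f i + esym_ratio k (X - {i}) f))"
proof -
  have "f i - (f i)\<^sup>2 / (f i + esym_ratio k (X - {i}) f)
      = f i * esym (Suc k) (X - {i}) f / esym (Suc k) X f" if i: "i \<in> X" for i
  proof -
    have "0 < esym (Suc k) X f" using GardingD[OF f, of "Suc k"] by simp
    then show ?thesis
      unfolding esym_ratio_remove(1)[OF X i f]
      using esym_remove[OF X i, of k f] by (simp add: field_simps power2_eq_square)
  qed
  then have "(\<Sum>i\<in>X. f i - (f i)\<^sup>2 / (f i + esym_ratio k (X - {i}) f))
      = (\<Sum>i\<in>X. f i * esym (Suc k) (X - {i}) f) / esym (Suc k) X f"
    by (simp add: sum_divide_distrib)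
  then show ?thesis unfolding esym_euler[OF X] by (simp add: esym_ratio_def)
qed

text \<open>For \<open>d > 0\<close>, \<open>z^2 / d\<close> is the supremum over \<open>s\<close>
  of \<open>2 * s * z - s^2 * d\<close>, which is linear in \<open>(z, d)\<close>. The value of
  \<open>s\<close> optimal for \<open>(x + y, c)\<close> serves both summands on the right.\<close>

lemma square_over_linear_subadd:
  fixes x y a b c :: real
  assumes "0 < a" "0 < b" "a + b \<le> c"
  shows "(x + y)\<^sup>2 / c \<le> x\<^sup>2 / a + y\<^sup>2 / b"
proof -
  define s where "s = (x + y) / c"
  have tangent: "2 * s * z - s\<^sup>2 * d \<le> z\<^sup>2 / d" if "0 < d" for z d
  proof -
    have "z\<^sup>2 / d - (2 * s * z - s\<^sup>2 * d) = (z - s * d)\<^sup>2 / d"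
      using that by (simp add: field_simps power2_eq_square)
    then show ?thesis using that by (smt (verit) divide_nonneg_pos zero_le_power2)
  qed
  have "0 < c" using assms by simp
  then have "(x + y)\<^sup>2 / c = 2 * s * (x + y) - s\<^sup>2 * c"
    by (simp add: s_def field_simps power2_eq_square)
  also have "\<dots> \<le> 2 * s * (x + y) - s\<^sup>2 * (a + b)"
    using assms by (simp add: mult_left_mono)
  also have "\<dots> \<le> x\<^sup>2 / a + y\<^sup>2 / b"
    using tangent[OF assms(1), of x] tangent[OF assms(2), of y] by (simp add: algebra_simps)
  finally show ?thesis .
qed

text \<open>The induction keeps \<open>X\<close> arbitrary because the recursion deletes a
  coordinate. Convexity of the cone is carried along: it makes the recursion applicable to the sum
  of \<open>f\<close> and \<open>g\<close>. For \<open>k = 0\<close> the quotient is the linear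
  function \<open>S_1\<close>.\<close>

lemma esym_ratio_superadd:
  assumes "finite X" "f \<in> Garding (Suc k) X" "g \<in> Garding (Suc k) X"
  shows "(\<lambda>i. f i + g i) \<in> Garding (Suc k) X \<and>
    esym_ratio k X f + esym_ratio k X g \<le> esym_ratio k X (\<lambda>i. f i + g i)"
  using assms
proof (induction k arbitrary: X)
  case 0
  then show ?case
    by (auto simp: Garding_def esym_ratio_def esym_1 sum.distrib le_Suc_eq)
next
  case (Suc k)
  let ?h = "\<lambda>i. f i + g i"
  note X = Suc.prems(1)
  have f: "f \<in> Garding (Suc k) X" and g: "g \<in> Garding (Suc k) X"
    using Suc.prems by (auto intro: Garding_antimono)
  then have h: "?h \<in> Garding (Suc k) X" using Suc.IH X by blast
  have le: "(f i - (f i)\<^sup>2 / (f i + esym_ratio k (X - {i}) f)) +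
      (g i - (g i)\<^sup>2 / (g i + esym_ratio k (X - {i}) g))
      \<le> ?h i - (?h i)\<^sup>2 / (?h i + esym_ratio k (X - {i}) ?h)" if i: "i \<in> X" for i
  proof -
    have "esym_ratio k (X - {i}) f + esym_ratio k (X - {i}) g \<le> esym_ratio k (X - {i}) ?h"
      using Suc.IH[of "X - {i}"] Garding_remove[OF X i] Suc.prems by auto
    then have "(?h i)\<^sup>2 / (?h i + esym_ratio k (X - {i}) ?h) \<le>
        (f i)\<^sup>2 / (f i + esym_ratio k (X - {i}) f) + (g i)\<^sup>2 / (g i + esym_ratio k (X - {i}) g)"
      using esym_ratio_remove(2)[OF X i f] esym_ratio_remove(2)[OF X i g]
      by (intro square_over_linear_subadd) auto
    then show ?thesis by simp
  qed
  have "real (Suc (Suc k)) * (esym_ratio (Suc k) X f + esym_ratio (Suc k) X g)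
      \<le> real (Suc (Suc k)) * esym_ratio (Suc k) X ?h"
    unfolding distrib_left esym_ratio_Suc[OF X f] esym_ratio_Suc[OF X g] esym_ratio_Suc[OF X h]
      sum.distrib[symmetric]
    by (rule sum_mono) (use le in auto)
  then have ratio: "esym_ratio (Suc k) X f + esym_ratio (Suc k) X g \<le> esym_ratio (Suc k) X ?h"
    by (simp only: mult_le_cancel_left_pos of_nat_0_less_iff zero_less_Suc)
  \<comment> \<open>Superadditivity itself yields the next level of the cone: the quotient of the
    sum dominates two positive ones.\<close>
  then have "0 < esym_ratio (Suc k) X ?h"
    using esym_ratio_pos[OF Suc.prems(2)] esym_ratio_pos[OF Suc.prems(3)] by linarith
  then have "0 < esym (Suc (Suc k)) X ?h"
    using GardingD[OF h, of "Suc k"] by (simp add: esym_ratio_def zero_less_divide_iff)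
  then show ?case using ratio Garding_SucI[OF h] by blast
qed

section \<open>Garding's inequality for vectors\<close>

lemma esym_eq_prod_ratio:
  assumes "finite X" "f \<in> Garding k X"
  shows "esym k X f = (\<Prod>j<k. esym_ratio j X f)"
  using assms(2)
proof (induction k)
  case (Suc k)
  have "f \<in> Garding k X" using Suc.prems by (auto intro: Garding_antimono)
  moreover from this have "esym (Suc k) X f = esym k X f * esym_ratio k X f"
    using GardingD[of f k X k] by (simp add: esym_ratio_def)
  ultimately show ?case using Suc.IH by simp
qed (use assms in simp)

lemma esym_has_derivative:
  assumes "finite X"
  shows "((\<lambda>t. esym (Suc j) X (\<lambda>i. f i + t * g i)) has_real_derivative
    (\<Sum>i\<in>X. g i * esym j (X - {i}) f)) (at 0)"
  using assms
proof (induction X arbitrary: j rule: finite_induct)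
  case (insert x X)
  have rem: "insert x X - {i} = insert x (X - {i})" if "i \<in> X" for i
    using that insert.hyps by auto
  have E: "esym (Suc j) (insert x X) (\<lambda>i. f i + t * g i) =
      esym (Suc j) X (\<lambda>i. f i + t * g i) + (f x + t * g x) * esym j X (\<lambda>i. f i + t * g i)" for t
    using insert.hyps by (simp add: esym_insert)
  have S: "(\<Sum>i\<in>insert x X. g i * esym j (insert x X - {i}) f) =
      g x * esym j X f + (\<Sum>i\<in>X. g i * esym j (insert x (X - {i})) f)"
    using insert.hyps by (simp add: rem)
  show ?case
  proof (cases j)
    case 0
    show ?thesis unfolding E S unfolding 0 using insert.hyps
      by (auto intro!: derivative_eq_intros insert.IH)
  next
    case (Suc m)
    have "(\<Sum>i\<in>X. g i * esym j (insert x (X - {i})) f) =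
        (\<Sum>i\<in>X. g i * esym j (X - {i}) f) + f x * (\<Sum>i\<in>X. g i * esym m (X - {i}) f)"
      using insert.hyps by (simp add: Suc esym_insert sum.distrib sum_distrib_left algebra_simps)
    then show ?thesis unfolding E S unfolding Suc
      by (auto intro!: derivative_eq_intros insert.IH simp: algebra_simps)
  qed
qed simp

text \<open>For \<open>t > 0\<close>, superadditivity of the quotients bounds
  \<open>S_k(f + t g)\<close> below by the product of the \<open>a j + t * b j\<close>, with
  equality at \<open>t = 0\<close>. Hence the right derivatives at 0 compare in the same way. The
  derivative of the product is \<open>F\<close> times the sum of the \<open>b j / a j\<close>, to
  which the inequality of arithmetic and geometric means applies.\<close>

lemma Garding_inequality:
  assumes X: "finite X" and f: "f \<in> Garding (Suc m) X" and g: "g \<in> Garding (Suc m) X"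
  defines "k \<equiv> real (Suc m)"
  shows "k * esym (Suc m) X f powr ((k - 1) / k) * esym (Suc m) X g powr (1 / k)
    \<le> (\<Sum>i\<in>X. g i * esym m (X - {i}) f)"
proof -
  define a b where "a j = esym_ratio j X f" and "b j = esym_ratio j X g" for j
  define F G where "F = esym (Suc m) X f" and "G = esym (Suc m) X g"
  have F: "F = prod a {..<Suc m}" "0 < F" and G: "G = prod b {..<Suc m}" "0 < G"
    using esym_eq_prod_ratio[OF X f] esym_eq_prod_ratio[OF X g] GardingD[OF f, of "Suc m"] GardingD[OF g, of "Suc m"]
    by (simp_all add: F_def G_def a_def b_def del: prod.lessThan_Suc)
  have pos: "0 < a j" "0 < b j" if "j < Suc m" for j
    using that f g by (auto simp: a_def b_def intro!: esym_ratio_pos elim!: Garding_antimono)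
  let ?D = "(\<Sum>i\<in>X. g i * esym m (X - {i}) f) - (\<Sum>j<Suc m. b j * prod a ({..<Suc m} - {j}))"
  let ?\<phi> = "\<lambda>t. esym (Suc m) X (\<lambda>i. f i + t * g i) - (\<Prod>j<Suc m. a j + t * b j)"
  have "((\<lambda>t. a j + t * b j) has_real_derivative b j) (at 0)" for j
    by (auto intro!: derivative_eq_intros)
  then have "((\<lambda>t. \<Prod>j<Suc m. a j + t * b j) has_real_derivative
      (\<Sum>j<Suc m. b j * (\<Prod>i\<in>{..<Suc m} - {j}. a i + 0 * b i))) (at 0)"
    by (intro has_field_derivative_prod)
  then have der: "(?\<phi> has_real_derivative ?D) (at 0)"
    by (intro DERIV_diff esym_has_derivative[OF X]) simp
  have nonneg: "0 \<le> ?\<phi> t" if t: "0 < t" for t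
  proof -
    let ?h = "\<lambda>i. f i + t * g i"
    have tg: "(\<lambda>i. t * g i) \<in> Garding (Suc m) X" using g t by (rule Garding_scale)
    have h: "?h \<in> Garding (Suc m) X" using esym_ratio_superadd[OF X f tg] by simp
    have "(\<Prod>j<Suc m. a j + t * b j) \<le> (\<Prod>j<Suc m. esym_ratio j X ?h)"
    proof (intro prod_mono conjI)
      fix j assume "j \<in> {..<Suc m}"
      then have j: "j < Suc m" by simp
      show "0 \<le> a j + t * b j" using pos[OF j] t by (simp add: less_imp_le)
      have "esym_ratio j X (\<lambda>i. t * g i) = t * b j"
        using t by (simp add: b_def esym_ratio_def esym_scale)
      then show "a j + t * b j \<le> esym_ratio j X ?h"
        using esym_ratio_superadd[OF X, of f j "\<lambda>i. t * g i"] Garding_antimono[OF f] Garding_antimono[OF tg] j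
        by (simp add: a_def)
    qed
    then show ?thesis using esym_eq_prod_ratio[OF X h] by simp
  qed
  \<comment> \<open>The difference of the two sides vanishes at 0 and is nonnegative to the right of
    0, so its derivative there cannot be negative.\<close>
  have "0 \<le> ?D"
  proof (rule ccontr)
    assume "\<not> 0 \<le> ?D"
    then have "?D < 0" by simp
    from DERIV_neg_dec_right[OF der this] obtain d where d: "0 < d"
      "\<And>h. 0 < h \<Longrightarrow> h < d \<Longrightarrow> ?\<phi> (0 + h) < ?\<phi> 0" by blast
    have "?\<phi> 0 = 0" using F by (simp add: F_def)
    moreover have "?\<phi> (0 + d / 2) < ?\<phi> 0" using d(1) by (intro d(2)) auto
    ultimately have "?\<phi> (d / 2) < 0" by (simp only: add_0_left)
    then show False using nonneg[of "d / 2"] d(1) by linarith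
  qed
  then have 1: "(\<Sum>j<Suc m. b j * prod a ({..<Suc m} - {j})) \<le> (\<Sum>i\<in>X. g i * esym m (X - {i}) f)"
    by simp
  have "(\<Sum>j<Suc m. b j * prod a ({..<Suc m} - {j})) = (\<Sum>j<Suc m. F * (b j / a j))"
  proof (intro sum.cong refl)
    fix j assume j: "j \<in> {..<Suc m}"
    then have "F = a j * prod a ({..<Suc m} - {j})" unfolding F(1) by (intro prod.remove) auto
    then show "b j * prod a ({..<Suc m} - {j}) = F * (b j / a j)" using pos(1)[of j] j by simp
  qed
  also have "\<dots> = F * k * (\<Sum>j<Suc m. b j / a j / card {..<Suc m})"
    unfolding sum_distrib_left by (intro sum.cong refl) (simp add: k_def)
  also have "\<dots> \<ge> F * k * (\<Prod>j<Suc m. b j / a j) powr (1 / card {..<Suc m})"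
    using F pos by (intro mult_left_mono arith_geom_mean) (auto simp: k_def less_imp_le)
  also have "(\<Prod>j<Suc m. b j / a j) = G / F" unfolding F(1) G(1) by (rule prod_dividef)
  also have "F * k * (G / F) powr (1 / card {..<Suc m}) = k * (F * F powr (- 1 / k)) * G powr (1 / k)"
    using F G by (simp add: k_def powr_divide powr_minus field_simps)
  also have "F * F powr (- 1 / k) = F powr (1 + (- 1 / k))"
    unfolding powr_add using F(2) by simp
  also have "1 + (- 1 / k) = (k - 1) / k" by (simp add: k_def field_simps)
  finally show ?thesis using 1 by (simp add: F_def G_def)
qed

section \<open>A rearrangement inequality for doubly stochastic matrices\<close>

text \<open>Linear programming duality: a potential \<open>F\<close> bounds each term's excess over
  the diagonal pairing from below. Averaged with \<open>P\<close>, the potential differences cancel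
  because rows and columns both sum to 1.\<close>

lemma doubly_stochastic_rearrangement:
  fixes P :: "nat \<Rightarrow> nat \<Rightarrow> real" and w \<mu> :: "nat \<Rightarrow> real"
  assumes nonneg: "\<And>i j. i < n \<Longrightarrow> j < n \<Longrightarrow> 0 \<le> P i j"
    and row: "\<And>i. i < n \<Longrightarrow> (\<Sum>j<n. P i j) = 1"
    and col: "\<And>j. j < n \<Longrightarrow> (\<Sum>i<n. P i j) = 1"
    and w: "\<And>i j. i \<le> j \<Longrightarrow> j < n \<Longrightarrow> w j \<le> w i"
    and \<mu>: "\<And>i j. i \<le> j \<Longrightarrow> j < n \<Longrightarrow> \<mu> i \<le> \<mu> j"
  shows "(\<Sum>i<n. \<mu> i * w i) \<le> (\<Sum>i<n. \<Sum>j<n. P i j * (w i * \<mu> j))"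
proof -
  \<comment> \<open>A discrete primitive of \<open>\<mu>\<close> along \<open>w\<close>; it plays the role of the dual potential
    of the assignment problem.\<close>
  define F where "F i = (\<Sum>t<i. \<mu> t * (w (Suc t) - w t))" for i
  \<comment> \<open>The increments of \<open>w\<close> are nonpositive, so replacing
    \<open>\<mu> t\<close> by \<open>\<mu> j\<close> between the two indices moves the sum in the
    required direction on either side of \<open>j\<close>.\<close>
  have pot: "F i - F j \<le> (w i - w j) * \<mu> j" if ij: "i < n" "j < n" for i j
  proof (cases "j \<le> i")
    case True
    have "F i - F j = (\<Sum>t=j..<i. \<mu> t * (w (Suc t) - w t))"
      unfolding F_def using True by (simp add: sum_diff_nat_ivl lessThan_atLeast0)
    also have "\<dots> \<le> (\<Sum>t=j..<i. \<mu> j * (w (Suc t) - w t))"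
      using ij \<mu> w by (intro sum_mono mult_right_mono_neg) auto
    also have "\<dots> = \<mu> j * (w i - w j)"
      using True by (simp add: sum_distrib_left[symmetric] sum_Suc_diff')
    finally show ?thesis by (simp add: mult.commute)
  next
    case False
    have "\<mu> j * (w j - w i) = (\<Sum>t=i..<j. \<mu> j * (w (Suc t) - w t))"
      using False by (simp add: sum_distrib_left[symmetric] sum_Suc_diff')
    also have "\<dots> \<le> (\<Sum>t=i..<j. \<mu> t * (w (Suc t) - w t))"
      using ij \<mu> w by (intro sum_mono mult_right_mono_neg) auto
    also have "\<dots> = F j - F i"
      unfolding F_def using False by (simp add: sum_diff_nat_ivl lessThan_atLeast0)
    finally show ?thesis by (simp add: algebra_simps)
  qed
  have marg: "(\<Sum>i<n. \<Sum>j<n. P i j * u i) = (\<Sum>i<n. u i)"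
    "(\<Sum>i<n. \<Sum>j<n. P i j * u j) = (\<Sum>j<n. u j)" for u
  proof -
    show "(\<Sum>i<n. \<Sum>j<n. P i j * u i) = (\<Sum>i<n. u i)"
      by (simp add: sum_distrib_right[symmetric] row)
    show "(\<Sum>i<n. \<Sum>j<n. P i j * u j) = (\<Sum>j<n. u j)"
      by (subst sum.swap) (simp add: sum_distrib_right[symmetric] col)
  qed
  have "0 = (\<Sum>i<n. \<Sum>j<n. P i j * (F i - F j))"
    by (simp add: right_diff_distrib sum_subtractf marg)
  also have "\<dots> \<le> (\<Sum>i<n. \<Sum>j<n. P i j * ((w i - w j) * \<mu> j))"
    using nonneg pot by (intro sum_mono mult_left_mono) auto
  also have "\<dots> = (\<Sum>i<n. \<Sum>j<n. P i j * (w i * \<mu> j)) - (\<Sum>i<n. \<Sum>j<n. P i j * (\<mu> j * w j))"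
    by (simp add: algebra_simps sum_subtractf)
  finally show ?thesis by (simp add: marg)
qed

section \<open>The spectral theorem for real symmetric matrices\<close>

text \<open>A complex eigenvector \<open>w\<close> exists. Symmetry makes its eigenvalue real, so
  the real and imaginary parts of \<open>w\<close> satisfy the same eigenvalue equation, and one of
  them is nonzero.\<close>

lemma real_symmetric_has_eigenvector:
  fixes A :: "real mat"
  assumes A: "A \<in> carrier_mat n n" and sym: "A\<^sup>T = A" and n: "0 < n"
  obtains e v where "v \<in> carrier_vec n" "v \<noteq> 0\<^sub>v n" "A *\<^sub>v v = e \<cdot>\<^sub>v v"
proof -
  let ?C = "map_mat complex_of_real A"
  have C: "?C \<in> carrier_mat n n" using A by simp
  obtain as where as: "char_poly ?C = (\<Prod>a\<leftarrow>as. [:- a, 1:])" "length as = n"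
    using char_poly_factorized[OF C] by blast
  then obtain z zs where "as = z # zs" using n by (cases as) auto
  then have "poly (char_poly ?C) z = 0" using as by simp
  then obtain w where w: "w \<in> carrier_vec n" "w \<noteq> 0\<^sub>v n" "?C *\<^sub>v w = z \<cdot>\<^sub>v w"
    using eigenvalue_root_char_poly[OF C] C unfolding eigenvalue_def eigenvector_def by auto
  define a b x y where "a = Re z" and "b = Im z"
    and "x i = Re (w $ i)" and "y i = Im (w $ i)" for i
  have mv: "(\<Sum>j<n. of_real (A $$ (i, j)) * w $ j) = z * w $ i" if i: "i < n" for i
  proof -
    have "(?C *\<^sub>v w) $ i = (\<Sum>j<n. of_real (A $$ (i, j)) * w $ j)"
      using A w(1) i by (simp add: scalar_prod_def atLeast0LessThan)
    then show ?thesis using w i by simp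
  qed
  have x: "(\<Sum>j<n. A $$ (i, j) * x j) = a * x i - b * y i" if "i < n" for i
    using arg_cong[OF mv[OF that], of Re] by (simp add: a_def b_def x_def y_def)
  have y: "(\<Sum>j<n. A $$ (i, j) * y j) = a * y i + b * x i" if "i < n" for i
    using arg_cong[OF mv[OF that], of Im] by (simp add: a_def b_def x_def y_def)
  have Asym: "A $$ (i, j) = A $$ (j, i)" if "i < n" "j < n" for i j
    using that A arg_cong[OF sym, of "\<lambda>M. M $$ (i, j)"] by simp
  \<comment> \<open>Symmetry of \<open>A\<close> equates the pairing of \<open>y\<close> with
    \<open>A x\<close> and that of \<open>x\<close> with \<open>A y\<close>; the terms in
    \<open>a\<close> cancel and leave \<open>b\<close> times the squared norm of
    \<open>w\<close>.\<close>
  have "(\<Sum>i<n. y i * (\<Sum>j<n. A $$ (i, j) * x j)) = (\<Sum>i<n. \<Sum>j<n. y i * A $$ (i, j) * x j)"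
    by (simp add: sum_distrib_left mult.assoc)
  also have "\<dots> = (\<Sum>j<n. \<Sum>i<n. y i * A $$ (i, j) * x j)" by (rule sum.swap)
  also have "\<dots> = (\<Sum>j<n. x j * (\<Sum>i<n. A $$ (j, i) * y i))"
    unfolding sum_distrib_left by (intro sum.cong refl) (simp add: Asym)
  finally have "(\<Sum>i<n. y i * (a * x i - b * y i)) = (\<Sum>i<n. x i * (a * y i + b * x i))"
    by (simp add: x y)
  then have "b * (\<Sum>i<n. (x i)\<^sup>2 + (y i)\<^sup>2) = 0"
    by (simp add: algebra_simps sum.distrib sum_subtractf sum_distrib_left power2_eq_square)
  moreover have "0 < (\<Sum>i<n. (x i)\<^sup>2 + (y i)\<^sup>2)"
  proof -
    obtain i where i: "i < n" "w $ i \<noteq> 0"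
      using w(1,2) by (metis carrier_vecD eq_vecI index_zero_vec)
    then have "0 < (x i)\<^sup>2 + (y i)\<^sup>2"
      by (auto simp: x_def y_def sum_power2_gt_zero_iff complex_eq_iff)
    then show ?thesis using i by (intro sum_pos2[of _ i]) auto
  qed
  ultimately have b: "b = 0" by auto
  have x_eig: "A *\<^sub>v vec n x = a \<cdot>\<^sub>v vec n x"
    using A x b by (intro eq_vecI) (auto simp: scalar_prod_def atLeast0LessThan)
  have y_eig: "A *\<^sub>v vec n y = a \<cdot>\<^sub>v vec n y"
    using A y b by (intro eq_vecI) (auto simp: scalar_prod_def atLeast0LessThan)
  have "vec n x \<noteq> 0\<^sub>v n \<or> vec n y \<noteq> 0\<^sub>v n"
  proof (rule ccontr)
    assume "\<not> ?thesis"
    then have "x i = 0" "y i = 0" if "i < n" for i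
      using that by (metis index_vec index_zero_vec(1))+
    then have "w = 0\<^sub>v n" using w(1) by (intro eq_vecI) (auto simp: x_def y_def complex_eq_iff)
    with w show False by simp
  qed
  then show ?thesis using that[of "vec n x" a] that[of "vec n y" a] x_eig y_eig by auto
qed

text \<open>Reflect in the hyperplane orthogonal to \<open>u = v - e_0\<close>, which exchanges
  \<open>e_0\<close> and \<open>v\<close>. As \<open>|u|^2 = 2 * (1 - v_0)\<close>, the usual
  coefficient \<open>2 / |u|^2\<close> is \<open>c\<close>. If \<open>v = e_0\<close>, then
  \<open>u\<close> vanishes and the identity serves.\<close>

lemma Householder_reflection:
  fixes v :: "real vec"
  assumes v: "v \<in> carrier_vec n" and n: "0 < n" and unit: "v \<bullet> v = 1"
  obtains H where "H \<in> carrier_mat n n" "H\<^sup>T = H" "H * H = 1\<^sub>m n" "col H 0 = v"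
proof (cases "v = unit_vec n 0")
  case True
  then show ?thesis using that[of "1\<^sub>m n"] n by simp
next
  case False
  define \<delta> where "\<delta> i j = (if i = j then 1 else 0 :: real)" for i j :: nat
  define u where "u i = v $ i - \<delta> i 0" for i
  define c where "c = 1 / (1 - v $ 0)"
  have vv: "(\<Sum>i<n. (v $ i)\<^sup>2) = 1"
    using unit v by (simp add: scalar_prod_def atLeast0LessThan power2_eq_square)
  have d0: "(\<Sum>i<n. f i * \<delta> i j) = f j" "(\<Sum>i<n. \<delta> i j * f i) = f j" "(\<Sum>i<n. \<delta> j i * f i) = f j"
    if "j < n" for f j
    using that by (simp_all add: \<delta>_def if_distrib[of "\<lambda>x. _ * x"] if_distrib[of "\<lambda>x. x * _"] cong: if_cong)
  have "(\<Sum>i<n. (u i)\<^sup>2) = (\<Sum>i<n. (v $ i)\<^sup>2) - 2 * (\<Sum>i<n. v $ i * \<delta> i 0) + (\<Sum>i<n. \<delta> i 0 * \<delta> i 0)"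
    by (simp add: u_def power2_eq_square algebra_simps sum.distrib sum_subtractf sum_distrib_left)
  then have uu: "(\<Sum>i<n. (u i)\<^sup>2) = 2 * (1 - v $ 0)"
    using n by (simp only: d0 vv) (simp add: \<delta>_def)
  have "v $ 0 \<noteq> 1"
  proof
    assume "v $ 0 = 1"
    then have "(\<Sum>i<n. (u i)\<^sup>2) = 0" using uu by simp
    then have "\<forall>i<n. u i = 0" by (simp add: sum_nonneg_eq_0_iff)
    then have "v = unit_vec n 0" using v by (intro eq_vecI) (auto simp: u_def \<delta>_def unit_vec_def)
    with False show False by simp
  qed
  then have c: "c * (1 - v $ 0) = 1" by (simp add: c_def)
  have "c * c * (\<Sum>i<n. (u i)\<^sup>2) = 2 * c * (c * (1 - v $ 0))" unfolding uu by simp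
  then have cuu: "c * c * (\<Sum>i<n. (u i)\<^sup>2) = 2 * c" using c by simp
  have cu0: "c * u 0 = - 1" using c by (simp add: u_def \<delta>_def algebra_simps)
  define H where "H = mat n n (\<lambda>(i, j). \<delta> i j - c * (u i * u j))"
  have H: "H \<in> carrier_mat n n" by (simp add: H_def)
  have "H\<^sup>T = H" by (intro eq_matI) (auto simp: H_def \<delta>_def)
  moreover have "H * H = 1\<^sub>m n"
  proof (intro eq_matI)
    fix i j assume "i < dim_row (1\<^sub>m n)" "j < dim_col (1\<^sub>m n)"
    then have ij: "i < n" "j < n" by simp_all
    have "(H * H) $$ (i, j) = (\<Sum>k<n. (\<delta> i k - c * (u i * u k)) * (\<delta> k j - c * (u k * u j)))"
      using ij by (simp add: H_def scalar_prod_def atLeast0LessThan)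
    also have "\<dots> = (\<Sum>k<n. \<delta> i k * \<delta> k j) - c * u j * (\<Sum>k<n. \<delta> i k * u k)
        - c * u i * (\<Sum>k<n. u k * \<delta> k j) + u i * u j * (c * c * (\<Sum>k<n. (u k)\<^sup>2))"
      by (simp add: algebra_simps sum.distrib sum_subtractf sum_distrib_left power2_eq_square)
    also have "\<dots> = \<delta> i j" using ij by (simp only: d0 cuu) simp
    finally show "(H * H) $$ (i, j) = (1\<^sub>m n) $$ (i, j)" using ij by (simp add: \<delta>_def)
  qed (simp_all add: H_def)
  moreover have "col H 0 = v"
  proof (intro eq_vecI)
    fix i assume "i < dim_vec v"
    then have i: "i < n" using v by simp
    have "col H 0 $ i = \<delta> i 0 - u i * (c * u 0)" using i n by (simp add: H_def)
    then show "col H 0 $ i = v $ i" unfolding cu0 by (simp add: u_def)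
  qed (use v in \<open>simp add: H_def\<close>)
  ultimately show ?thesis using that H by blast
qed

lemma transpose_four_block_diag:
  assumes "A \<in> carrier_mat k k" "B \<in> carrier_mat m m"
  shows "(four_block_mat A (0\<^sub>m k m) (0\<^sub>m m k) B)\<^sup>T = four_block_mat A\<^sup>T (0\<^sub>m k m) (0\<^sub>m m k) B\<^sup>T"
  using assms by (subst transpose_four_block_mat[of _ k k _ m _ m]) auto

lemma mult_four_block_diag:
  fixes A B A' B' :: "'a :: semiring_1 mat"
  assumes "A \<in> carrier_mat k k" "B \<in> carrier_mat m m" "A' \<in> carrier_mat k k" "B' \<in> carrier_mat m m"
  shows "four_block_mat A (0\<^sub>m k m) (0\<^sub>m m k) B * four_block_mat A' (0\<^sub>m k m) (0\<^sub>m m k) B'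
    = four_block_mat (A * A') (0\<^sub>m k m) (0\<^sub>m m k) (B * B')"
  using assms by (subst mult_four_block_mat[of _ k k _ m _ m _ _ k _ m]) auto

text \<open>Deflation: conjugating by a reflection that sends \<open>e_0\<close> to a unit
  eigenvector clears the first column off the diagonal, hence by symmetry the first row. The
  remaining block is diagonalised by induction.\<close>

lemma real_symmetric_spectral:
  fixes A :: "real mat"
  assumes "A \<in> carrier_mat n n" "A\<^sup>T = A"
  shows "\<exists>U d. U \<in> carrier_mat n n \<and> U\<^sup>T * U = 1\<^sub>m n \<and> A = U * mat_diag n d * U\<^sup>T"
  using assms
proof (induction n arbitrary: A)
  case 0
  then show ?case by (intro exI[of _ "1\<^sub>m 0"] exI[of _ "\<lambda>_. 0"] conjI eq_matI) auto
next
  case (Suc n)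
  let ?N = "Suc n"
  note A = Suc.prems(1) and sym = Suc.prems(2)
  obtain e v' where v': "v' \<in> carrier_vec ?N" "v' \<noteq> 0\<^sub>v ?N" "A *\<^sub>v v' = e \<cdot>\<^sub>v v'"
    using real_symmetric_has_eigenvector[OF A sym] by blast
  define r where "r = v' \<bullet> v'"
  have r: "0 < r"
  proof -
    obtain i where "i < ?N" "v' $ i \<noteq> 0"
      using v'(1,2) by (metis carrier_vecD eq_vecI index_zero_vec)
    then have "0 < (\<Sum>i<?N. (v' $ i)\<^sup>2)"
      by (intro sum_pos2[of _ i]) auto
    then show ?thesis
      using v'(1) by (simp add: r_def scalar_prod_def atLeast0LessThan power2_eq_square)
  qed
  define v where "v = (1 / sqrt r) \<cdot>\<^sub>v v'"
  have v: "v \<in> carrier_vec ?N" using v' by (simp add: v_def)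
  have "v \<bullet> v = 1" using v' r by (simp add: v_def r_def[symmetric])
  moreover have Av: "A *\<^sub>v v = e \<cdot>\<^sub>v v"
    using v' A by (simp add: v_def mult_mat_vec smult_smult_assoc mult.commute)
  ultimately obtain H where H: "H \<in> carrier_mat ?N ?N" "H\<^sup>T = H" "H * H = 1\<^sub>m ?N" "col H 0 = v"
    using Householder_reflection[OF v] by blast
  define B where "B = H * A * H"
  have B: "B \<in> carrier_mat ?N ?N" using H A by (simp add: B_def)
  have "B\<^sup>T = H\<^sup>T * (H * A)\<^sup>T" unfolding B_def using H A by (intro transpose_mult) auto
  also have "(H * A)\<^sup>T = A\<^sup>T * H\<^sup>T" using H A by (intro transpose_mult) auto
  finally have Bsym: "B\<^sup>T = B" using H A sym by (simp add: B_def)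
  have Hv: "H *\<^sub>v v = unit_vec ?N 0"
  proof -
    have "col (H * H) 0 = H *\<^sub>v col H 0" by (rule col_mult2[OF H(1,1)]) simp
    then show ?thesis unfolding H(3,4) by simp
  qed
  have "col B 0 = (H * A) *\<^sub>v v" unfolding B_def using H A by (subst col_mult2[of _ ?N ?N _ ?N]) auto
  also have "\<dots> = H *\<^sub>v (A *\<^sub>v v)" using H A v by (intro assoc_mult_mat_vec) auto
  also have "\<dots> = e \<cdot>\<^sub>v unit_vec ?N 0" using H v by (simp add: Av mult_mat_vec Hv)
  finally have col: "col B 0 = e \<cdot>\<^sub>v unit_vec ?N 0" .
  have col0: "B $$ (i, 0) = (if i = 0 then e else 0)" if "i < ?N" for i
    using that B arg_cong[OF col, of "\<lambda>u. u $ i"] by (simp add: unit_vec_def)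
  then have row0: "B $$ (0, i) = (if i = 0 then e else 0)" if "i < ?N" for i
    using that B arg_cong[OF Bsym, of "\<lambda>M. M $$ (i, 0)"] by simp
  define A' where "A' = mat n n (\<lambda>(i, j). B $$ (Suc i, Suc j))"
  have A': "A' \<in> carrier_mat n n" by (simp add: A'_def)
  have "A'\<^sup>T = A'"
  proof (intro eq_matI)
    fix i j assume "i < dim_row A'" "j < dim_col A'"
    then have "i < n" "j < n" by (simp_all add: A'_def)
    then show "A'\<^sup>T $$ (i, j) = A' $$ (i, j)"
      using B arg_cong[OF Bsym, of "\<lambda>M. M $$ (Suc i, Suc j)"] by (simp add: A'_def)
  qed (simp_all add: A'_def)
  from Suc.IH[OF A' this] obtain U d where U: "U \<in> carrier_mat n n" "U\<^sup>T * U = 1\<^sub>m n"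
    and A'_eq: "A' = U * mat_diag n d * U\<^sup>T" by blast
  define blk where "blk X Y = four_block_mat X (0\<^sub>m 1 n) (0\<^sub>m n 1) Y" for X Y :: "real mat"
  define V where "V = blk (1\<^sub>m 1) U"
  \<comment> \<open>\<open>case_nat e d\<close> puts the new eigenvalue \<open>e\<close> first and
    shifts the old ones by one.\<close>
  define D where "D = mat_diag ?N (case_nat e d)"
  have V: "V \<in> carrier_mat ?N ?N"
    using four_block_carrier_mat[of "1\<^sub>m 1" 1 1 U n n "0\<^sub>m 1 n" "0\<^sub>m n 1"] U by (simp add: V_def blk_def)
  have D: "D \<in> carrier_mat ?N ?N" by (simp add: D_def)
  have VT: "V\<^sup>T = blk (1\<^sub>m 1) U\<^sup>T"
    unfolding V_def blk_def using U by (subst transpose_four_block_diag) auto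
  have D_blk: "D = blk (mat 1 1 (\<lambda>_. e)) (mat_diag n d)"
    by (intro eq_matI) (auto simp: D_def blk_def mat_diag_def split: nat.split)
  have B_blk: "B = blk (mat 1 1 (\<lambda>_. e)) A'"
    using B row0 col0 by (intro eq_matI) (auto simp: blk_def A'_def)
  have "V * D * V\<^sup>T = blk (1\<^sub>m 1 * mat 1 1 (\<lambda>_. e) * 1\<^sub>m 1) (U * mat_diag n d * U\<^sup>T)"
    unfolding VT D_blk unfolding V_def blk_def using U
    by (simp add: mult_four_block_diag[of _ 1 _ n] del: One_nat_def)
  then have VDV: "V * D * V\<^sup>T = B"
    unfolding B_blk A'_eq[symmetric] by (simp del: One_nat_def)
  have "V\<^sup>T * V = blk (1\<^sub>m 1 * 1\<^sub>m 1) (U\<^sup>T * U)"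
    unfolding VT unfolding V_def blk_def using U by (intro mult_four_block_diag) auto
  then have VV: "V\<^sup>T * V = 1\<^sub>m ?N" unfolding U by (simp add: blk_def)
  define W where "W = H * V"
  have W: "W \<in> carrier_mat ?N ?N" using H V by (simp add: W_def)
  have WT: "W\<^sup>T = V\<^sup>T * H" unfolding W_def using H V by (subst transpose_mult[of _ ?N ?N _ ?N]) auto
  have "W\<^sup>T * W = V\<^sup>T * (H * (H * V))" unfolding WT unfolding W_def using H V
    by (intro assoc_mult_mat[of _ ?N ?N _ ?N _ ?N]) auto
  also have "H * (H * V) = (H * H) * V" using H V by (intro assoc_mult_mat[symmetric]) auto
  finally have 1: "W\<^sup>T * W = 1\<^sub>m ?N" using H V VV by simp
  have "W * D * W\<^sup>T = H * B * H"
  proof -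
    have "W * D * W\<^sup>T = H * (V * D) * (V\<^sup>T * H)"
      unfolding WT unfolding W_def using H V D by (simp add: assoc_mult_mat[of _ ?N ?N _ ?N _ ?N])
    also have "\<dots> = H * (V * D * V\<^sup>T) * H"
      using H V D by (simp add: assoc_mult_mat[of _ ?N ?N _ ?N _ ?N])
    finally show ?thesis by (simp add: VDV)
  qed
  also have "\<dots> = (H * H) * A * (H * H)"
    unfolding B_def using H(1) A by (simp add: assoc_mult_mat[of _ ?N ?N _ ?N _ ?N])
  also have "\<dots> = A" using H A by simp
  finally show ?case using W 1 unfolding D_def by (intro exI[of _ W] exI[of _ "case_nat e d"]) auto
qed

section \<open>Eigenvalues and principal minors\<close>

lemma char_poly_spectral:
  fixes A :: "real mat"
  assumes U: "U \<in> carrier_mat n n" "U\<^sup>T * U = 1\<^sub>m n" and A: "A = U * mat_diag n d * U\<^sup>T"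
  shows "char_poly A = (\<Prod>i<n. [:- d i, 1:])"
proof -
  have UT: "U\<^sup>T \<in> carrier_mat n n" using U by simp
  have "U * U\<^sup>T = 1\<^sub>m n" using mat_mult_left_right_inverse[OF UT U(1) U(2)] .
  then have "similar_mat_wit A (mat_diag n d) U U\<^sup>T"
    using U A by (intro similar_mat_witI[of _ _ n]) auto
  then have "char_poly A = char_poly (mat_diag n d)"
    by (intro char_poly_similar) (auto simp: similar_mat_def)
  also have "\<dots> = (\<Prod>a \<leftarrow> diag_mat (mat_diag n d). [:- a, 1:])"
    by (intro char_poly_upper_triangular[of _ n]) (auto simp: mat_diag_def)
  also have "diag_mat (mat_diag n d) = map d [0..<n]"
    by (simp add: diag_mat_def mat_diag_def)
  also have "(\<Prod>a \<leftarrow> map d [0..<n]. [:- a, 1:]) = (\<Prod>i<n. [:- d i, 1:])"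
    by (simp add: o_def prod.distinct_set_conv_list[symmetric] atLeast0LessThan)
  finally show ?thesis .
qed

lemma spectral_index:
  fixes U :: "real mat"
  assumes "U \<in> carrier_mat n n" "i < n" "j < n"
  shows "(U * mat_diag n d * U\<^sup>T) $$ (i, j) = (\<Sum>k<n. U $$ (i, k) * d k * U $$ (j, k))"
  using assms mat_diag_mult_right[of U n n d]
  by (simp add: scalar_prod_def atLeast0LessThan)

lemma orthogonal_sum_delta:
  fixes U :: "real mat"
  assumes "U \<in> carrier_mat n n" "U\<^sup>T * U = 1\<^sub>m n" "i < n" "j < n"
  shows "(\<Sum>k<n. U $$ (k, i) * U $$ (k, j)) = (if i = j then 1 else 0)"
  using arg_cong[OF assms(2), of "\<lambda>M. M $$ (i, j)"] assms(1,3,4)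
  by (simp add: scalar_prod_def atLeast0LessThan)

text \<open>The spectral theorem yields the eigenvalues in some order. The characteristic polynomial
  identifies them as a multiset with the sorted list, and permuting the columns of \<open>U\<close>
  accordingly keeps it orthogonal.\<close>

lemma spectral_eigenvalue_vec:
  fixes A :: "real mat"
  assumes A: "A \<in> carrier_mat n n" and sym: "A\<^sup>T = A"
  defines "l \<equiv> \<lambda>i. eigenvalue_vec A $ i"
  shows "dim_vec (eigenvalue_vec A) = n"
    and "\<And>i j. i \<le> j \<Longrightarrow> j < n \<Longrightarrow> l i \<le> l j"
    and "\<exists>U. U \<in> carrier_mat n n \<and> U\<^sup>T * U = 1\<^sub>m n \<and> A = U * mat_diag n l * U\<^sup>T"
proof -
  obtain U d where U: "U \<in> carrier_mat n n" "U\<^sup>T * U = 1\<^sub>m n" and AU: "A = U * mat_diag n d * U\<^sup>T"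
    using real_symmetric_spectral[OF A sym] by blast
  define xs where "xs = sorted_list_of_multiset (proots (char_poly A))"
  have "proots (char_poly A) = (\<Sum>i<n. proots [:- d i, 1:])"
    unfolding char_poly_spectral[OF U AU] by (intro proots_prod) simp
  also have "\<dots> = mset (map d [0..<n])"
    by (simp add: sum_unfold_sum_mset atLeast0LessThan[symmetric])
  finally have ms: "mset xs = mset (map d [0..<n])" by (simp add: xs_def)
  then have len: "length xs = n" by (metis length_map length_upt diff_zero size_mset)
  have l: "l i = xs ! i" if "i < n" for i
    using that len by (simp add: l_def eigenvalue_vec_def xs_def vec_of_list_index)
  show "dim_vec (eigenvalue_vec A) = n"
    using len by (simp add: eigenvalue_vec_def xs_def)
  have "sorted xs" by (simp add: xs_def)
  then show "l i \<le> l j" if "i \<le> j" "j < n" for i j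
    using that len by (simp add: l sorted_nth_mono)
  obtain p where p: "p permutes {..<n}" "permute_list p (map d [0..<n]) = xs"
    using mset_eq_permutation[OF ms] by auto
  have lp: "l i = d (p i)" and pn: "p i < n" if "i < n" for i
  proof -
    show "p i < n" using p(1) that permutes_in_image[of p "{..<n}" i] by simp
    then show "l i = d (p i)"
      using that p permute_list_nth[of p "map d [0..<n]" i] by (simp add: l)
  qed
  define W where "W = mat n n (\<lambda>(i, j). U $$ (i, p j))"
  have W: "W \<in> carrier_mat n n" by (simp add: W_def)
  have "W\<^sup>T * W = 1\<^sub>m n"
  proof (intro eq_matI)
    fix i j assume "i < dim_row (1\<^sub>m n)" "j < dim_col (1\<^sub>m n)"
    then have ij: "i < n" "j < n" by simp_all
    have "(W\<^sup>T * W) $$ (i, j) = (\<Sum>k<n. U $$ (k, p i) * U $$ (k, p j))"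
      using ij pn by (simp add: W_def scalar_prod_def atLeast0LessThan)
    also have "\<dots> = (if p i = p j then 1 else 0)"
      by (rule orthogonal_sum_delta[OF U pn[OF ij(1)] pn[OF ij(2)]])
    also have "p i = p j \<longleftrightarrow> i = j" using p(1) by (auto dest: permutes_inj injD)
    finally show "(W\<^sup>T * W) $$ (i, j) = (1\<^sub>m n) $$ (i, j)" using ij by simp
  qed (simp_all add: W_def)
  moreover have "A = W * mat_diag n l * W\<^sup>T"
  proof (intro eq_matI)
    fix i j assume "i < dim_row (W * mat_diag n l * W\<^sup>T)" "j < dim_col (W * mat_diag n l * W\<^sup>T)"
    then have ij: "i < n" "j < n" by (simp_all add: W_def)
    have "A $$ (i, j) = (\<Sum>k<n. U $$ (i, k) * d k * U $$ (j, k))"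
      unfolding AU by (rule spectral_index[OF U(1) ij])
    also have "\<dots> = (\<Sum>k<n. U $$ (i, p k) * d (p k) * U $$ (j, p k))"
      using sum.permute[OF p(1), of "\<lambda>k. U $$ (i, k) * d k * U $$ (j, k)"] by (simp add: o_def)
    also have "\<dots> = (\<Sum>k<n. W $$ (i, k) * l k * W $$ (j, k))"
      using ij by (intro sum.cong refl) (simp add: W_def lp)
    also have "\<dots> = (W * mat_diag n l * W\<^sup>T) $$ (i, j)"
      by (rule spectral_index[OF W ij, symmetric])
    finally show "A $$ (i, j) = (W * mat_diag n l * W\<^sup>T) $$ (i, j)" .
  qed (use A in \<open>simp_all add: W_def\<close>)
  ultimately show "\<exists>U. U \<in> carrier_mat n n \<and> U\<^sup>T * U = 1\<^sub>m n \<and> A = U * mat_diag n l * U\<^sup>T"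
    using W by blast
qed

text \<open>Vieta's formula with factors \<open>x - l i\<close>, whence the sign. It lets the
  symmetric functions of a submatrix be read off without knowing its eigenvalues.\<close>

lemma elem_sym_mat_coeff_char_poly:
  fixes A :: "real mat"
  assumes A: "A \<in> carrier_mat n n" and sym: "A\<^sup>T = A" and "m + j = n"
  shows "elem_sym_mat j A = (- 1) ^ j * coeff (char_poly A) m"
proof -
  let ?l = "\<lambda>i. eigenvalue_vec A $ i"
  obtain U where U: "U \<in> carrier_mat n n" "U\<^sup>T * U = 1\<^sub>m n" "A = U * mat_diag n ?l * U\<^sup>T"
    using spectral_eigenvalue_vec(3)[OF A sym] by blast
  have "coeff (char_poly A) m = esym j {..<n} (\<lambda>i. - ?l i)"
    unfolding char_poly_spectral[OF U] using assms(3) by (intro coeff_prod_linear) simp_all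
  also have "\<dots> = (- 1) ^ j * esym j {..<n} ?l"
    using esym_scale[of j "{..<n}" "- 1" ?l] by simp
  finally show ?thesis
    by (simp add: elem_sym_mat_def elem_sym_eq_esym spectral_eigenvalue_vec(1)[OF A sym] flip: power_mult_distrib)
qed

section \<open>Matrices with one index deleted\<close>

lemma pick_remove:
  assumes "i < n" "a < n - 1"
  shows "pick ({..<n} - {i}) a = insert_index i a"
proof -
  let ?J = "{..<n} - {i}"
  have mem: "insert_index i a \<in> ?J" using assms by (auto simp: insert_index_def)
  \<comment> \<open>A member of \<open>?J\<close> is found by \<open>pick\<close> from the number of
    smaller members; these are the images of the \<open>a\<close> indices below
    \<open>a\<close>.\<close>
  have "{x \<in> ?J. x < insert_index i a} = insert_index i ` {..<a}"
  proof (intro equalityI subsetI)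
    fix x assume x: "x \<in> {x \<in> ?J. x < insert_index i a}"
    then have "x = insert_index i (delete_index i x)" by (simp add: insert_delete_index)
    moreover have "delete_index i x < a"
      using x by (auto simp: delete_index_def insert_index_def split: if_splits)
    ultimately show "x \<in> insert_index i ` {..<a}" by blast
  next
    fix x assume "x \<in> insert_index i ` {..<a}"
    then show "x \<in> {x \<in> ?J. x < insert_index i a}"
      using assms by (auto simp: insert_index_def split: if_splits)
  qed
  then have "card {x \<in> ?J. x < insert_index i a} = a"
    by (simp add: card_image insert_index_inj_on)
  then show ?thesis using pick_card_in_set[OF mem] by simp
qed

lemma principal_submatrix_eq_mat_delete:
  assumes A: "A \<in> carrier_mat n n" and i: "i < n"
  shows "principal_submatrix A ({..<n} - {i}) = mat_delete A i i"
proof -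
  have "{j. j < n \<and> j \<in> {..<n} - {i}} = {..<n} - {i}" by auto
  then have card: "card {j. j < n \<and> j \<in> {..<n} - {i}} = n - 1" using i by simp
  have "principal_submatrix A ({..<n} - {i}) = mat (n - 1) (n - 1)
      (\<lambda>(a, b). A $$ (pick ({..<n} - {i}) a, pick ({..<n} - {i}) b))"
    unfolding principal_submatrix_def submatrix_def carrier_matD[OF A] card ..
  also have "\<dots> = mat_delete A i i"
    using A pick_remove[OF i] by (intro eq_matI) (simp_all add: mat_delete_def insert_index_def)
  finally show ?thesis .
qed

text \<open>Both sides evaluate at \<open>x\<close> to the \<open>i\<close>-th diagonal entry of the
  adjugate of \<open>x I - A\<close>: the left as a principal minor, the right through
  diagonalisation. The comparison is made after multiplication by the determinant.\<close>

lemma char_poly_mat_delete_spectral: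
  fixes A :: "real mat"
  assumes U: "U \<in> carrier_mat n n" "U\<^sup>T * U = 1\<^sub>m n" and AU: "A = U * mat_diag n d * U\<^sup>T"
    and i: "i < n"
  shows "char_poly (mat_delete A i i) =
    (\<Sum>j<n. smult ((U $$ (i, j))\<^sup>2) (\<Prod>l\<in>{..<n} - {j}. [:- d l, 1:]))" (is "?p = ?q")
proof -
  have A: "A \<in> carrier_mat n n" unfolding AU using U(1) by (simp add: mult_carrier_mat[of _ n n _ n])
  have UT: "U\<^sup>T \<in> carrier_mat n n" using U by simp
  have UU: "U * U\<^sup>T = 1\<^sub>m n" using mat_mult_left_right_inverse[OF UT U(1) U(2)] .
  have eval: "poly (char_poly A) x * poly ?p x = poly (char_poly A) x * poly ?q x" for x
  proof -
    \<comment> \<open>The adjugate of \<open>x I - A\<close> is \<open>U N U\<^sup>T\<close>, where \<open>N\<close> is the adjugate of the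
      diagonal matrix \<open>x I - D\<close>.\<close>
    define M where "M = U * mat_diag n (\<lambda>l. x - d l) * U\<^sup>T"
    define N where "N = U * mat_diag n (\<lambda>j. \<Prod>l\<in>{..<n} - {j}. (x - d l)) * U\<^sup>T"
    define c where "c = (\<Prod>l<n. x - d l)"
    have M: "M \<in> carrier_mat n n" and N: "N \<in> carrier_mat n n" using U(1)
      by (simp_all add: M_def N_def mult_carrier_mat[of _ n n _ n])
    \<comment> \<open>\<open>char_matrix A x\<close> stands for \<open>A - x I\<close>, hence the
      sign.\<close>
    have M_eq: "M = - char_matrix A x"
    proof (intro eq_matI)
      fix a b assume "a < dim_row (- char_matrix A x)" "b < dim_col (- char_matrix A x)"
      then have ab: "a < n" "b < n" using A by (simp_all add: char_matrix_def)
      have orth: "(\<Sum>k<n. U $$ (a, k) * U $$ (b, k)) = (if a = b then 1 else 0)"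
        using arg_cong[OF UU, of "\<lambda>M. M $$ (a, b)"] U(1) ab by (simp add: scalar_prod_def atLeast0LessThan)
      have "M $$ (a, b) = x * (\<Sum>k<n. U $$ (a, k) * U $$ (b, k)) - A $$ (a, b)"
        unfolding M_def AU spectral_index[OF U(1) ab]
        by (simp add: algebra_simps sum_subtractf sum_distrib_left)
      then show "M $$ (a, b) = (- char_matrix A x) $$ (a, b)"
        using ab A by (simp add: orth char_matrix_def)
    qed (use M A in \<open>simp_all add: char_matrix_def\<close>)
    have det: "det M = c"
      unfolding M_eq char_poly_matrix[OF A, symmetric] char_poly_spectral[OF U AU]
      by (simp add: c_def poly_prod)
    have "M * N = U * (mat_diag n (\<lambda>l. x - d l) * (U\<^sup>T * U) * mat_diag n (\<lambda>j. \<Prod>l\<in>{..<n} - {j}. (x - d l))) * U\<^sup>T"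
      unfolding M_def N_def using U(1) UT
      by (simp add: assoc_mult_mat[of _ n n _ n _ n] mult_carrier_mat[of _ n n _ n])
    also have "mat_diag n (\<lambda>l. x - d l) * (U\<^sup>T * U) * mat_diag n (\<lambda>j. \<Prod>l\<in>{..<n} - {j}. (x - d l)) = c \<cdot>\<^sub>m 1\<^sub>m n"
    proof -
      have "(x - d a) * (\<Prod>l\<in>{..<n} - {a}. (x - d l)) = c" if "a < n" for a
        using that by (simp add: c_def prod.remove[of "{..<n}" a])
      then have "mat_diag n (\<lambda>a. (x - d a) * (\<Prod>l\<in>{..<n} - {a}. (x - d l))) = c \<cdot>\<^sub>m 1\<^sub>m n"
        by (intro eq_matI) (auto simp: mat_diag_def)
      then show ?thesis unfolding U right_mult_one_mat[OF mat_diag_dim] mat_diag_diag .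
    qed
    also have "U * (c \<cdot>\<^sub>m 1\<^sub>m n) * U\<^sup>T = c \<cdot>\<^sub>m 1\<^sub>m n"
      using U(1) UU by (simp add: mult_smult_distrib[of _ n n _ n] mult_smult_assoc_mat[of _ n n _ n])
    finally have MN: "M * N = c \<cdot>\<^sub>m 1\<^sub>m n" .
    \<comment> \<open>Evaluating \<open>adj_mat M * M * N\<close> in two ways compares
      \<open>N\<close> with the adjugate up to the factor \<open>c\<close>, also when
      \<open>M\<close> is singular.\<close>
    have "c \<cdot>\<^sub>m N = (adj_mat M * M) * N"
      using adj_mat(3)[OF M] N by (simp add: det mult_smult_assoc_mat[of _ n n _ n])
    also have "\<dots> = adj_mat M * (M * N)" using adj_mat(1)[OF M] M N by (intro assoc_mult_mat)
    also have "\<dots> = c \<cdot>\<^sub>m adj_mat M"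
      unfolding MN using adj_mat(1)[OF M] by (simp add: mult_smult_distrib[of _ n n _ n])
    finally have "c * N $$ (i, i) = c * adj_mat M $$ (i, i)"
      using i N adj_mat(1)[OF M] by (metis carrier_matD index_smult_mat(1))
    moreover have "N $$ (i, i) = poly ?q x"
      unfolding N_def spectral_index[OF U(1) i i]
      by (simp add: poly_sum poly_prod power2_eq_square mult_ac)
    moreover have "adj_mat M $$ (i, i) = poly ?p x"
    proof -
      have "mat_delete M i i = - char_matrix (mat_delete A i i) x"
        unfolding M_eq using A i
        by (intro eq_matI) (auto simp: mat_delete_def char_matrix_def)
      then have "det (mat_delete M i i) = poly ?p x"
        using char_poly_matrix[OF mat_delete_carrier[OF A]] by simp
      then show ?thesis using M i by (simp add: adj_mat_def cofactor_def)
    qed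
    moreover have "poly (char_poly A) x = c"
      using det unfolding M_eq char_poly_matrix[OF A] .
    ultimately show ?thesis by (simp only:)
  qed
  \<comment> \<open>At an eigenvalue \<open>x\<close> the pointwise identity is void. The factor is
    therefore cancelled between polynomials, where \<open>char_poly A\<close> is monic and so
    nonzero.\<close>
  have "poly (char_poly A * ?p) = poly (char_poly A * ?q)"
    by (rule ext) (simp only: poly_mult eval)
  then have "char_poly A * ?p = char_poly A * ?q"
    by (simp only: poly_eq_poly_eq_iff)
  moreover have "char_poly A \<noteq> 0"
    using degree_monic_char_poly[OF A] by auto
  ultimately show ?thesis by simp
qed

text \<open>Compare coefficients in degree \<open>n - 1 - k\<close>; the signs from Vieta's formula
  on the two sides cancel.\<close>

lemma elem_sym_mat_principal_submatrix:
  fixes A :: "real mat"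
  assumes U: "U \<in> carrier_mat n n" "U\<^sup>T * U = 1\<^sub>m n" and AU: "A = U * mat_diag n d * U\<^sup>T"
    and A: "A \<in> carrier_mat n n" and sym: "A\<^sup>T = A" and i: "i < n" and k: "k < n"
  shows "elem_sym_mat k (principal_submatrix A ({..<n} - {i})) =
    (\<Sum>j<n. (U $$ (i, j))\<^sup>2 * esym k ({..<n} - {j}) d)"
proof -
  define m where "m = n - 1 - k"
  have m: "m + k = n - 1" using k by (simp add: m_def)
  let ?B = "mat_delete A i i"
  have B: "?B \<in> carrier_mat (n - 1) (n - 1)" by (rule mat_delete_carrier[OF A])
  have Asym: "A $$ (a, b) = A $$ (b, a)" if "a < n" "b < n" for a b
    using that A arg_cong[OF sym, of "\<lambda>M. M $$ (a, b)"] by simp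
  have "?B\<^sup>T = ?B"
    using A by (intro eq_matI) (auto simp: mat_delete_def intro!: Asym)
  then have "elem_sym_mat k ?B = (- 1) ^ k * coeff (char_poly ?B) m"
    using elem_sym_mat_coeff_char_poly[OF B _ m] by blast
  also have "\<dots> = (\<Sum>j<n. (U $$ (i, j))\<^sup>2 * ((- 1) ^ k * coeff (\<Prod>l\<in>{..<n} - {j}. [:- d l, 1:]) m))"
    unfolding char_poly_mat_delete_spectral[OF U AU i]
    by (simp add: coeff_sum sum_distrib_left mult_ac)
  also have "\<dots> = (\<Sum>j<n. (U $$ (i, j))\<^sup>2 * esym k ({..<n} - {j}) d)"
  proof (intro sum.cong refl arg_cong2[of _ _ _ _ "(*)"])
    fix j assume "j \<in> {..<n}"
    then have "coeff (\<Prod>l\<in>{..<n} - {j}. [:- d l, 1:]) m = esym k ({..<n} - {j}) (\<lambda>l. - d l)"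
      using m by (intro coeff_prod_linear) simp_all
    also have "\<dots> = (- 1) ^ k * esym k ({..<n} - {j}) d"
      using esym_scale[of k "{..<n} - {j}" "- 1" d] by simp
    finally show "(- 1) ^ k * coeff (\<Prod>l\<in>{..<n} - {j}. [:- d l, 1:]) m = esym k ({..<n} - {j}) d"
      by (simp flip: power_mult_distrib)
  qed
  finally show ?thesis unfolding principal_submatrix_eq_mat_delete[OF A i] .
qed

section \<open>From matrices to eigenvalue vectors, and the conclusion\<close>

lemma k_positiveD:
  assumes "k_positive k n A"
  shows "A \<in> carrier_mat n n" "A\<^sup>T = A"
    "(\<lambda>i. eigenvalue_vec A $ i) \<in> Garding k {..<n}"
    "elem_sym_mat k A = esym k {..<n} (\<lambda>i. eigenvalue_vec A $ i)"
proof -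
  show A: "A \<in> carrier_mat n n" "A\<^sup>T = A" using assms by (simp_all add: k_positive_def)
  have pos: "0 < elem_sym j (eigenvalue_vec A)" if "1 \<le> j" "j \<le> k" for j
    using assms that by (auto simp: k_positive_def Gamma_cone_def)
  show "(\<lambda>i. eigenvalue_vec A $ i) \<in> Garding k {..<n}"
    unfolding Garding_def
  proof (intro CollectI allI impI)
    fix j assume "j \<le> k"
    \<comment> \<open>The case \<open>j = 0\<close> is outside the range in
      \<open>Gamma_cone\<close>; there the value is 1.\<close>
    then show "0 < esym j {..<n} (\<lambda>i. eigenvalue_vec A $ i)"
      using pos[of j] spectral_eigenvalue_vec(1)[OF A] by (cases j) (auto simp: elem_sym_eq_esym)
  qed
  show "elem_sym_mat k A = esym k {..<n} (\<lambda>i. eigenvalue_vec A $ i)"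
    by (simp add: elem_sym_mat_def elem_sym_eq_esym spectral_eigenvalue_vec(1)[OF A])
qed

text \<open>The two sides differ by \<open>f j - f i\<close> times \<open>S_k\<close> of the
  coordinates without \<open>i\<close> and \<open>j\<close>, which is positive after two
  deletions.\<close>

lemma esym_remove_antimono:
  assumes X: "finite X" "i \<in> X" "j \<in> X" and f: "f \<in> Garding (Suc (Suc k)) X" and le: "f i \<le> f j"
  shows "esym (Suc k) (X - {j}) f \<le> esym (Suc k) (X - {i}) f"
proof (cases "i = j")
  case False
  have "f \<in> Garding k (X - {i} - {j})"
    using X f False by (intro Garding_remove) auto
  then have "0 < esym k (X - {i} - {j}) f" by (rule GardingD) simp
  moreover have "X - {j} - {i} = X - {i} - {j}" by auto
  ultimately show ?thesis
    using X False le esym_remove[of "X - {j}" i k f] esym_remove[of "X - {i}" j k f]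
    by (simp add: mult_right_mono)
qed simp

theorem corollary1p6:
  fixes n k :: nat and A B :: "real mat"
  assumes "2 \<le> k" and "k \<le> n"
    and "k_positive k n A" and "k_positive k n B"
  shows "(\<Sum>i<n. B $$ (i, i) * elem_sym_mat (k - 1) (principal_submatrix A ({..<n} - {i})))
    \<ge> real k * elem_sym_mat k A powr ((real k - 1) / real k)
        * elem_sym_mat k B powr (1 / real k)"
proof -
  \<comment> \<open>Two levels of the cone are set aside for the two deletions that show
    \<open>w\<close> to be decreasing.\<close>
  obtain m where k: "k = Suc (Suc m)" using assms(1) by (metis add_2_eq_Suc le_Suc_ex)
  note A = k_positiveD[OF assms(3)] and B = k_positiveD[OF assms(4)]
  define l \<mu> where "l i = eigenvalue_vec A $ i" and "\<mu> i = eigenvalue_vec B $ i" for i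
  obtain U where U: "U \<in> carrier_mat n n" "U\<^sup>T * U = 1\<^sub>m n" "A = U * mat_diag n l * U\<^sup>T"
    using spectral_eigenvalue_vec(3)[OF A(1,2)] unfolding l_def by blast
  obtain V where V: "V \<in> carrier_mat n n" "V\<^sup>T * V = 1\<^sub>m n" "B = V * mat_diag n \<mu> * V\<^sup>T"
    using spectral_eigenvalue_vec(3)[OF B(1,2)] unfolding \<mu>_def by blast
  define w where "w j = esym (k - 1) ({..<n} - {j}) l" for j
  \<comment> \<open>The transposed entrywise square of \<open>U\<close> times the entrywise square
    of \<open>V\<close>; both squares are doubly stochastic by orthogonality, hence so is the
    product.\<close>
  define P where "P j t = (\<Sum>i<n. (U $$ (i, j))\<^sup>2 * (V $$ (i, t))\<^sup>2)" for j t
  have unit: "(\<Sum>i<n. (W $$ (i, j))\<^sup>2) = 1" "(\<Sum>i<n. (W $$ (j, i))\<^sup>2) = 1"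
    if W: "W \<in> carrier_mat n n" "W\<^sup>T * W = 1\<^sub>m n" and j: "j < n" for W :: "real mat" and j
  proof -
    have WT: "W\<^sup>T \<in> carrier_mat n n" using W by simp
    have "(W\<^sup>T)\<^sup>T * W\<^sup>T = 1\<^sub>m n" using mat_mult_left_right_inverse[OF WT W(1) W(2)] by simp
    then show "(\<Sum>i<n. (W $$ (i, j))\<^sup>2) = 1" "(\<Sum>i<n. (W $$ (j, i))\<^sup>2) = 1"
      using orthogonal_sum_delta[OF W j j] orthogonal_sum_delta[OF WT _ j j] W j
      by (simp_all add: power2_eq_square)
  qed
  have "(\<Sum>i<n. B $$ (i, i) * elem_sym_mat (k - 1) (principal_submatrix A ({..<n} - {i})))
      = (\<Sum>i<n. (\<Sum>t<n. (V $$ (i, t))\<^sup>2 * \<mu> t) * (\<Sum>j<n. (U $$ (i, j))\<^sup>2 * w j))"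
  proof (intro sum.cong refl arg_cong2[of _ _ _ _ "(*)"])
    fix i assume "i \<in> {..<n}"
    then have i: "i < n" by simp
    show "B $$ (i, i) = (\<Sum>t<n. (V $$ (i, t))\<^sup>2 * \<mu> t)"
      unfolding V(3) spectral_index[OF V(1) i i] by (simp add: power2_eq_square mult_ac)
    show "elem_sym_mat (k - 1) (principal_submatrix A ({..<n} - {i})) = (\<Sum>j<n. (U $$ (i, j))\<^sup>2 * w j)"
      unfolding w_def using assms(1,2)
      by (intro elem_sym_mat_principal_submatrix[OF U A(1,2) i]) simp
  qed
  also have "\<dots> = (\<Sum>i<n. (\<Sum>j<n. (U $$ (i, j))\<^sup>2 * w j) * (\<Sum>t<n. (V $$ (i, t))\<^sup>2 * \<mu> t))"
    by (intro sum.cong refl mult.commute)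
  also have "\<dots> = (\<Sum>i<n. \<Sum>j<n. \<Sum>t<n. (U $$ (i, j))\<^sup>2 * (V $$ (i, t))\<^sup>2 * (w j * \<mu> t))"
    unfolding sum_product by (intro sum.cong refl) (simp add: mult_ac)
  also have "\<dots> = (\<Sum>j<n. \<Sum>i<n. \<Sum>t<n. (U $$ (i, j))\<^sup>2 * (V $$ (i, t))\<^sup>2 * (w j * \<mu> t))"
    by (rule sum.swap)
  also have "\<dots> = (\<Sum>j<n. \<Sum>t<n. P j t * (w j * \<mu> t))"
    unfolding P_def sum_distrib_right by (intro sum.cong refl sum.swap)
  also have "\<dots> \<ge> (\<Sum>j<n. \<mu> j * w j)"
  proof (rule doubly_stochastic_rearrangement)
    fix j assume j: "j < n"
    have "(\<Sum>t<n. P j t) = (\<Sum>i<n. (U $$ (i, j))\<^sup>2 * (\<Sum>t<n. (V $$ (i, t))\<^sup>2))"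
      unfolding P_def sum_distrib_left by (rule sum.swap)
    then show "(\<Sum>t<n. P j t) = 1" using unit(2)[OF V(1,2)] unit(1)[OF U(1,2) j] by simp
    have "(\<Sum>t<n. P t j) = (\<Sum>i<n. (\<Sum>t<n. (U $$ (i, t))\<^sup>2) * (V $$ (i, j))\<^sup>2)"
      unfolding P_def sum_distrib_right by (rule sum.swap)
    then show "(\<Sum>t<n. P t j) = 1" using unit(2)[OF U(1,2)] unit(1)[OF V(1,2) j] by simp
  next
    fix i j :: nat assume ij: "i \<le> j" "j < n"
    show "w j \<le> w i"
      unfolding w_def k diff_Suc_1
      using ij A(3) spectral_eigenvalue_vec(2)[OF A(1,2) ij]
      by (intro esym_remove_antimono) (auto simp: k l_def[abs_def])
    show "\<mu> i \<le> \<mu> j" unfolding \<mu>_def by (rule spectral_eigenvalue_vec(2)[OF B(1,2) ij])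
  qed (simp add: P_def sum_nonneg)
  finally have "(\<Sum>j<n. \<mu> j * w j)
    \<le> (\<Sum>i<n. B $$ (i, i) * elem_sym_mat (k - 1) (principal_submatrix A ({..<n} - {i})))" .
  \<comment> \<open>The \<open>w j\<close> are the partial derivatives of \<open>S_k\<close> at
    \<open>l\<close>, so this is Garding's inequality in direction \<open>\<mu>\<close>.\<close>
  moreover have "real k * elem_sym_mat k A powr ((real k - 1) / real k) * elem_sym_mat k B powr (1 / real k)
    \<le> (\<Sum>j<n. \<mu> j * w j)"
    using Garding_inequality[of "{..<n}" l "Suc m" \<mu>] A(3) B(3)
    unfolding A(4) B(4) w_def by (simp add: k l_def[abs_def] \<mu>_def[abs_def])
  ultimately show ?thesis by linarith
qed

end
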